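(* Let $n\geq 2$, and let $M$ be any of $\mathcal P_n$, $\mathcal{PB}_n$, $\mathcal{PP}_n$ or $\mathcal M_n$. Let $Q=\{\varepsilon\in P(M):\operatorname{rank}(\varepsilon)\leq2\}$, let $Q^-=Q\cup\{-\}$ where $-$ is a symbol not in $Q$, and let $\mu:Q^-\times M\to Q^-$ be the action given by $$\mu(\varepsilon,\alpha)=\begin{cases}\alpha^*\varepsilon\alpha&\text{if $\varepsilon\in Q$ and $\ker(\varepsilon)=\ker(\varepsilon\alpha)$}\\ -&\text{otherwise.}\end{cases}$$ Then $\mu$ is faithful and monogenic, and consequently $$\deg(M)\leq\deg_{\mathrm{rc}}(M)\leq 1+|Q|.$$
   Context: Diagram monoids. For an integer $n\ge 0$ let $\mathbf n=\{1,\dots,n\}$ and $\mathbf n'=\{1',\dots,n'\}$. The partition monoid $\mathcal P_n$ is the set of all set partitions of $\mathbf n\cup\mathbf n'$. Product of $\alpha,\beta\in\mathcal P_n$: with $\mathbf n''=\{1'',\dots,n''\}$, rename each $x'$ in $\alpha$ as $x''$ and each (unprimed) $x$ in $\beta$ as $x''$; consider the equivalence on $\mathbf n\cup\mathbf n''\cup\mathbf n'$ generated by the blocks of these two renamed partitions; $x,y\in\mathbf n\cup\mathbf n'$ are in the same block of $\alpha\beta$ iff they are related by this equivalence. This is a monoid with identity the partition with blocks $\{x,x'\}$. $\alpha^*$ is obtained from $\alpha$ by interchanging $x$ and $x'$ for all $x$. $\operatorname{rank}(\alpha)$ is the number of blocks of $\alpha$ meeting both $\mathbf n$ and $\mathbf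 n'$. $\ker(\alpha)=\{(x,y)\in\mathbf n\times\mathbf n: x,y\text{ lie in the same block of }\alpha\}$. $\alpha$ is planar if it can be drawn by a graph, whose connected components are the blocks, with vertices $1,\dots,n$ in order on an upper row and $1',\dots,n'$ in order on a lower row, with all edges inside the rectangle spanned by the vertices and with no crossings (equivalently, $\alpha$ is a non-crossing partition for the cyclic order $1,\dots,n,n',\dots,1'$). Submonoids: $\mathcal{PB}_n$ (partial Brauer monoid) = all blocks of size $\leq 2$; $\mathcal{PP}_n$ (planar partition monoid) = planar partitions; $\mathcal M_n=\mathcal{PP}_n\cap\mathcal{PB}_n$ (Motzkin monoid). $P(M)=\{\varepsilon\in M:\varepsilon^2=\varepsilon=\varepsilon^*\}$ is the set of projections. Actions. A right action of a semigroup $S$ on $X$ is a map $\mu:X\times S\to X$ with $\mu(\mu(x,a),b)=\mu(x,ab)$. It is faithful if distinct elements of $S$ induce distinct maps $X\to X$. It is monogenic if for some $x\in X$ we have $X=\{x\}\cup\{\mu(x,a):a\in S\}$. Degrees. For a finite semigroup $S$, $\deg(S)$ is the least $m\geq1$ such that $S$ embeds (via an injective semigroup homomorphism) in the monoid $\mathcal T_m$ of all self-maps of $\{1,\dots,m\}$ composed left to right. A right congruence $\sigma$ on $S$ is an equivalence with $(a,b)\in\sigma\Rightarrow(as,bs)\in\sigma$ for all $s \in S$; it gives an action of $S$ on $S/\sigma$ by $([x]_\sigma,a)\mapsto[xa]_\sigma$. $\deg_{\mathrm{rc}}(S)$ is the minimum of $|S/\sigma|$ over right congruences $\sigma$ whose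 associated action is faithful. *)

theory Defs
  imports "HOL-Algebra.Group" "HOL-Library.Disjoint_Sets"
begin

section \<open>Partitions and their product\<close>

text \<open>\<open>Up x\<close>, \<open>Lo x\<close> and \<open>Mid x\<close> stand for the vertices $x$, $x'$ and $x''$.
  Vertices \<open>Mid x\<close> occur only inside the definition of the product.\<close>

datatype vertex = Up nat | Mid nat | Lo nat

type_synonym diagram = "vertex set set"

definition upper :: "nat \<Rightarrow> vertex set" where
  "upper n = Up ` {1..n}"

definition lower :: "nat \<Rightarrow> vertex set" where
  "lower n = Lo ` {1..n}"

definition verts :: "nat \<Rightarrow> vertex set" where
  "verts n = upper n \<union> lower n"

definition partitions :: "nat \<Rightarrow> diagram set" where
  "partitions n = {\<alpha>. partition_on (verts n) \<alpha>}"

fun lo_to_mid :: "vertex \<Rightarrow> vertex" where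
  "lo_to_mid (Up x) = Up x"
| "lo_to_mid (Mid x) = Mid x"
| "lo_to_mid (Lo x) = Mid x"

fun up_to_mid :: "vertex \<Rightarrow> vertex" where
  "up_to_mid (Up x) = Mid x"
| "up_to_mid (Mid x) = Mid x"
| "up_to_mid (Lo x) = Lo x"

definition stacked_blocks :: "diagram \<Rightarrow> diagram \<Rightarrow> vertex set set" where
  "stacked_blocks \<alpha> \<beta> = image lo_to_mid ` \<alpha> \<union> image up_to_mid ` \<beta>"

text \<open>The relation \<open>\<Union>C. C \<times> C\<close> is symmetric, and reflexive on the union of the blocks, so its
  transitive closure is the equivalence on that union generated by the blocks.\<close>

definition stacked_equiv :: "diagram \<Rightarrow> diagram \<Rightarrow> (vertex \<times> vertex) set" where
  "stacked_equiv \<alpha> \<beta> = (\<Union>C\<in>stacked_blocks \<alpha> \<beta>. C \<times> C)\<^sup>+"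

definition diagram_mult :: "nat \<Rightarrow> diagram \<Rightarrow> diagram \<Rightarrow> diagram" where
  "diagram_mult n \<alpha> \<beta> = verts n // (stacked_equiv \<alpha> \<beta> \<inter> verts n \<times> verts n)"

definition diagram_one :: "nat \<Rightarrow> diagram" where
  "diagram_one n = (\<lambda>x. {Up x, Lo x}) ` {1..n}"

fun flip :: "vertex \<Rightarrow> vertex" where
  "flip (Up x) = Lo x"
| "flip (Mid x) = Mid x"
| "flip (Lo x) = Up x"

definition star :: "diagram \<Rightarrow> diagram" where
  "star \<alpha> = image flip ` \<alpha>"

definition rank :: "diagram \<Rightarrow> nat" where
  "rank \<alpha> = card {B \<in> \<alpha>. (\<exists>x. Up x \<in> B) \<and> (\<exists>y. Lo y \<in> B)}"

definition ker :: "diagram \<Rightarrow> (nat \<times> nat) set" where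
  "ker \<alpha> = {(x, y). \<exists>B\<in>\<alpha>. Up x \<in> B \<and> Up y \<in> B}"


section \<open>The diagram monoids\<close>

text \<open>The position of a vertex in the cyclic order $1, \dots, n, n', \dots, 1'$, cut open just
  before $1$.\<close>

fun pos :: "nat \<Rightarrow> vertex \<Rightarrow> nat" where
  "pos n (Up x) = x"
| "pos n (Lo x) = 2 * n + 1 - x"
| "pos n (Mid x) = 0"

definition planar :: "nat \<Rightarrow> diagram \<Rightarrow> bool" where
  "planar n \<alpha> \<longleftrightarrow>
     (\<nexists>A B a b c d. A \<in> \<alpha> \<and> B \<in> \<alpha> \<and> A \<noteq> B \<and> a \<in> A \<and> c \<in> A \<and> b \<in> B \<and> d \<in> B \<and>
        pos n a < pos n b \<and> pos n b < pos n c \<and> pos n c < pos n d)"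

definition diagram_monoid :: "nat \<Rightarrow> diagram set \<Rightarrow> diagram monoid" where
  "diagram_monoid n D = \<lparr>carrier = D, mult = diagram_mult n, one = diagram_one n\<rparr>"

definition partition_monoid :: "nat \<Rightarrow> diagram monoid" where
  "partition_monoid n = diagram_monoid n (partitions n)"

definition partial_brauer_monoid :: "nat \<Rightarrow> diagram monoid" where
  "partial_brauer_monoid n =
     diagram_monoid n {\<alpha> \<in> partitions n. \<forall>B\<in>\<alpha>. card B \<le> 2}"

definition planar_partition_monoid :: "nat \<Rightarrow> diagram monoid" where
  "planar_partition_monoid n = diagram_monoid n {\<alpha> \<in> partitions n. planar n \<alpha>}"

definition motzkin_monoid :: "nat \<Rightarrow> diagram monoid" where
  "motzkin_monoid n =
     diagram_monoid n (carrier (planar_partition_monoid n) \<inter> carrier (partial_brauer_monoid n))"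

definition projections :: "diagram monoid \<Rightarrow> diagram set" where
  "projections M = {\<epsilon> \<in> carrier M. \<epsilon> \<otimes>\<^bsub>M\<^esub> \<epsilon> = \<epsilon> \<and> \<epsilon> = star \<epsilon>}"


section \<open>Actions and degrees of semigroups\<close>

text \<open>Semigroups are given by the fields \<open>carrier\<close> and \<open>mult\<close> of a \<open>monoid\<close> record; the field
  \<open>one\<close> is ignored throughout this section.\<close>

definition right_action :: "('a, 'c) monoid_scheme \<Rightarrow> 'x set \<Rightarrow> ('x \<Rightarrow> 'a \<Rightarrow> 'x) \<Rightarrow> bool" where
  "right_action S X \<mu> \<longleftrightarrow>
     (\<forall>x\<in>X. \<forall>a\<in>carrier S. \<mu> x a \<in> X) \<and>
     (\<forall>x\<in>X. \<forall>a\<in>carrier S. \<forall>b\<in>carrier S. \<mu> (\<mu> x a) b = \<mu> x (a \<otimes>\<^bsub>S\<^esub> b))"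

definition faithful_action :: "('a, 'c) monoid_scheme \<Rightarrow> 'x set \<Rightarrow> ('x \<Rightarrow> 'a \<Rightarrow> 'x) \<Rightarrow> bool" where
  "faithful_action S X \<mu> \<longleftrightarrow>
     (\<forall>a\<in>carrier S. \<forall>b\<in>carrier S. a \<noteq> b \<longrightarrow> (\<exists>x\<in>X. \<mu> x a \<noteq> \<mu> x b))"

definition monogenic_action :: "('a, 'c) monoid_scheme \<Rightarrow> 'x set \<Rightarrow> ('x \<Rightarrow> 'a \<Rightarrow> 'x) \<Rightarrow> bool" where
  "monogenic_action S X \<mu> \<longleftrightarrow> (\<exists>x\<in>X. X = {x} \<union> {\<mu> x a | a. a \<in> carrier S})"

text \<open>Maps are composed left to right: \<open>f \<otimes> g\<close> sends \<open>x\<close> to \<open>g (f x)\<close>.\<close>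

definition full_transformation_monoid :: "nat \<Rightarrow> (nat \<Rightarrow> nat) monoid" where
  "full_transformation_monoid m =
     \<lparr>carrier = {1..m} \<rightarrow>\<^sub>E {1..m},
      mult = (\<lambda>f g. compose {1..m} g f),
      one = (\<lambda>x\<in>{1..m}. x)\<rparr>"

text \<open>The members of \<open>mon\<close> are the injective multiplicative maps; they need not preserve \<open>one\<close>.\<close>

definition deg :: "('a, 'c) monoid_scheme \<Rightarrow> nat" where
  "deg S = (LEAST m. m \<ge> 1 \<and> (\<exists>f. f \<in> mon S (full_transformation_monoid m)))"

definition right_congruence :: "('a, 'c) monoid_scheme \<Rightarrow> ('a \<times> 'a) set \<Rightarrow> bool" where
  "right_congruence S \<sigma> \<longleftrightarrow>
     equiv (carrier S) \<sigma> \<and>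
     (\<forall>a b. (a, b) \<in> \<sigma> \<longrightarrow> (\<forall>s\<in>carrier S. (a \<otimes>\<^bsub>S\<^esub> s, b \<otimes>\<^bsub>S\<^esub> s) \<in> \<sigma>))"

text \<open>The union below ranges over equal classes, since \<open>\<sigma>\<close> is a right congruence; it is the
  class of \<open>x \<otimes> a\<close> for any representative \<open>x\<close> of \<open>A\<close>.\<close>

definition quotient_action ::
  "('a, 'c) monoid_scheme \<Rightarrow> ('a \<times> 'a) set \<Rightarrow> 'a set \<Rightarrow> 'a \<Rightarrow> 'a set" where
  "quotient_action S \<sigma> A a = (\<Union>x\<in>A. \<sigma> `` {x \<otimes>\<^bsub>S\<^esub> a})"

text \<open>For a finite monoid the minimum exists, since equality is a right congruence with a faithful
  action.\<close>

definition deg_rc :: "('a, 'c) monoid_scheme \<Rightarrow> nat" where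
  "deg_rc S = (LEAST k. \<exists>\<sigma>. right_congruence S \<sigma> \<and>
     faithful_action S (carrier S // \<sigma>) (quotient_action S \<sigma>) \<and> k = card (carrier S // \<sigma>))"

end

theory Submission
  imports Defs
begin

text \<open>A diagram is determined by the pairs $(F, G)$ of subsets of $\{1,\dots,n\}$ for which
  $F \cup G'$ is a union of blocks. On these relations the product of diagrams is relational
  composition and the involution is the converse; they are closed under symmetric difference, whence
  $\alpha\alpha^*\alpha = \alpha$; and their domains determine, and are determined by, the kernels.
  So $\ker\beta$ determines $\ker(\alpha\beta)$, and $\mu$ is an action because
  $\alpha^*\varepsilon\alpha = \gamma^*\gamma$ for $\gamma = \varepsilon\alpha$.

  The partial identities on at most two points already separate diagrams: rank 0 detects the
  cokernel, rank 1 the transversal blocks, and rank 2 the kernel. The action is generated by the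
  partial identity $\varepsilon$ on $\{1, 2\}$: a projection $\delta$ of rank at most 2 is
  $\alpha^*\varepsilon\alpha$ for $\alpha = \tau\delta$, where the strands of $\tau$ join $1, 2$ in
  order to representatives of the transversal blocks of $\delta$. The degree bounds follow, since
  a faithful monogenic action of a monoid yields a right congruence with a faithful action.\<close>

section \<open>Degrees of finite monoids\<close>

text \<open>The two rows of a diagram are detected differently. The values \<alpha>* \<epsilon>
  \<alpha> on partial identities of rank at most 1 give the lower and the transversal links of
  \<alpha>, while the kernel of \<alpha> is read off from the case distinction that sends \<epsilon>
  to the extra point. For a partial identity on at most one point that distinction is vacuous; on
  two points it asks whether they are linked. This is where rank 2 comes from. The generator has
  rank 2 because conjugation never raises the rank. Relations settle associativity, the involution
  and kernels, but they show neither block sizes nor crossings. Closure of the partial Brauer and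
  the planar diagrams under products therefore needs the stacked graph itself: walks in the first
  case, gluing the middle rows one pair of points at a time in the second. All other diagrams
  required are monotone strands and a single cup, which have small blocks and are planar, so the
  four monoids can be treated at once.\<close>

lemma quotient_action_class:
  assumes \<sigma>: "right_congruence S \<sigma>" and c: "c \<in> carrier S" and a: "a \<in> carrier S"
  shows "quotient_action S \<sigma> (\<sigma> `` {c}) a = \<sigma> `` {c \<otimes>\<^bsub>S\<^esub> a}"
proof -
  have eq: "equiv (carrier S) \<sigma>" 
    and cong: "\<And>x y s. (x, y) \<in> \<sigma> \<Longrightarrow> s \<in> carrier S \<Longrightarrow> (x \<otimes>\<^bsub>S\<^esub> s, y \<otimes>\<^bsub>S\<^esub> s) \<in> \<sigma>"
    using \<sigma> unfolding right_congruence_def by auto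
  have "\<sigma> `` {x \<otimes>\<^bsub>S\<^esub> a} = \<sigma> `` {c \<otimes>\<^bsub>S\<^esub> a}" if "x \<in> \<sigma> `` {c}" for x
    using cong[of c x a] that a equiv_class_eq[OF eq] by blast
  moreover have "c \<in> \<sigma> `` {c}"
    using equiv_class_self[OF eq c] .
  ultimately show ?thesis
    unfolding quotient_action_def by blast
qed

lemma mult_full_transformation_monoid:
  assumes "x \<in> {1..m}"
  shows "(f \<otimes>\<^bsub>full_transformation_monoid m\<^esub> g) x = g (f x)"
  using assms by (simp add: full_transformation_monoid_def compose_def)

text \<open>Enumerating the classes by \<open>h\<close> turns the action into self-maps of an
  initial segment of the positive integers; faithfulness becomes injectivity of
  \<open>f\<close>.\<close>

lemma faithful_right_congruence_imp_mon:
  assumes S: "monoid S"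
    and \<sigma>: "right_congruence S \<sigma>"
    and faithful: "faithful_action S (carrier S // \<sigma>) (quotient_action S \<sigma>)"
    and fin: "finite (carrier S // \<sigma>)"
  shows "\<exists>f. f \<in> mon S (full_transformation_monoid (card (carrier S // \<sigma>)))"
proof -
  interpret monoid S by (fact S)
  let ?X = "carrier S // \<sigma>" and ?\<mu> = "quotient_action S \<sigma>"
  let ?m = "card ?X"
  let ?T = "full_transformation_monoid ?m"
  obtain h where h: "bij_betw h {1..?m} ?X"
    using fin by (metis ex_bij_betw_nat_finite_1)
  let ?g = "inv_into {1..?m} h"
  have g: "bij_betw ?g ?X {1..?m}"
    using h by (rule bij_betw_inv_into)
  have hg: "h (?g A) = A" if "A \<in> ?X" for A
    using h that by (simp add: bij_betw_inv_into_right)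
  have h_in: "h i \<in> ?X" if "i \<in> {1..?m}" for i
    using h that by (auto simp: bij_betw_def)
  have g_in: "?g A \<in> {1..?m}" if "A \<in> ?X" for A
    using g that by (meson bij_betwE)
  have closed: "?\<mu> A a \<in> ?X" if A: "A \<in> ?X" and a: "a \<in> carrier S" for A a
    using A
  proof (rule quotientE)
    fix c assume "A = \<sigma> `` {c}" "c \<in> carrier S"
    then show ?thesis
      using a by (simp add: quotient_action_class[OF \<sigma>] quotientI)
  qed
  have act: "?\<mu> (?\<mu> A a) b = ?\<mu> A (a \<otimes>\<^bsub>S\<^esub> b)"
    if A: "A \<in> ?X" and a: "a \<in> carrier S" and b: "b \<in> carrier S" for A a b
    using A
  proof (rule quotientE)
    fix c assume "A = \<sigma> `` {c}" "c \<in> carrier S"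
    then show ?thesis
      using a b by (simp add: quotient_action_class[OF \<sigma>] m_assoc)
  qed
  define f where "f = (\<lambda>a. \<lambda>i\<in>{1..?m}. ?g (?\<mu> (h i) a))"
  have f_app: "f a i = ?g (?\<mu> (h i) a)" if "i \<in> {1..?m}" for a i
    using that by (simp add: f_def)
  have f_in: "f a i \<in> {1..?m}" if "a \<in> carrier S" "i \<in> {1..?m}" for a i
    using g_in[OF closed[OF h_in]] that by (simp only: f_app)
  have f_car: "f a \<in> carrier ?T" if "a \<in> carrier S" for a
    using f_in[OF that] unfolding full_transformation_monoid_def
    by (simp add: PiE_iff extensional_def) (simp add: f_def)
  have "f (a \<otimes>\<^bsub>S\<^esub> b) = f a \<otimes>\<^bsub>?T\<^esub> f b" if a: "a \<in> carrier S" and b: "b \<in> carrier S" for a b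
  proof (rule ext)
    fix i
    show "f (a \<otimes>\<^bsub>S\<^esub> b) i = (f a \<otimes>\<^bsub>?T\<^esub> f b) i"
    proof (cases "i \<in> {1..?m}")
      case True
      have "f b (f a i) = ?g (?\<mu> (h (f a i)) b)"
        using f_app f_in[OF a True] by blast
      also have "\<dots> = ?g (?\<mu> (?\<mu> (h i) a) b)"
        unfolding f_app[OF True] hg[OF closed[OF h_in[OF True] a]] ..
      also have "\<dots> = f (a \<otimes>\<^bsub>S\<^esub> b) i"
        unfolding f_app[OF True] act[OF h_in[OF True] a b] ..
      finally show ?thesis
        by (simp only: mult_full_transformation_monoid[OF True])
    next
      \<comment> \<open>Outside the index set both maps take the value \<open>undefined\<close>, as
        elements of the transformation monoid must.\<close>
      case False
      then show ?thesis
        by (simp add: f_def full_transformation_monoid_def compose_def del: atLeastAtMost_iff)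
    qed
  qed
  then have "f \<in> hom S ?T"
    using f_car by (simp add: hom_def)
  moreover have "inj_on f (carrier S)"
  proof (rule inj_onI, rule ccontr)
    fix a b assume ab: "a \<in> carrier S" "b \<in> carrier S" "f a = f b" "a \<noteq> b"
    then obtain A where A: "A \<in> ?X" "?\<mu> A a \<noteq> ?\<mu> A b"
      using faithful unfolding faithful_action_def by blast
    have "?g (?\<mu> A a) = ?g (?\<mu> A b)"
      using f_app[OF g_in[OF A(1)]] hg[OF A(1)] ab(3) by metis
    then show False
      using A closed[OF A(1)] ab g by (metis bij_betw_def inj_onD)
  qed
  ultimately show ?thesis
    unfolding mon_def by blast
qed

lemma deg_le_deg_rc:
  assumes S: "monoid S" and fin: "finite (carrier S)"
  shows "deg S \<le> deg_rc S"
proof -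
  interpret monoid S by (fact S)
  let ?P = "\<lambda>k. \<exists>\<sigma>. right_congruence S \<sigma> \<and>
     faithful_action S (carrier S // \<sigma>) (quotient_action S \<sigma>) \<and> k = card (carrier S // \<sigma>)"
  \<comment> \<open>Equality is a witness for the \<open>LEAST\<close> in \<open>deg_rc\<close>. Its
    action is faithful because the class of the identity is sent by \<open>a\<close> to the class of
    \<open>a\<close>.\<close>
  let ?I = "Id_on (carrier S)"
  have I: "right_congruence S ?I"
    by (auto simp: right_congruence_def equiv_def refl_on_def sym_def trans_def Id_on_def)
  have "?I `` {\<one>\<^bsub>S\<^esub>} \<in> carrier S // ?I"
    by (simp only: quotientI one_closed)
  moreover have "quotient_action S ?I (?I `` {\<one>\<^bsub>S\<^esub>}) a = {a}" if "a \<in> carrier S" for a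
    using that by (subst quotient_action_class[OF I]) auto
  ultimately have "faithful_action S (carrier S // ?I) (quotient_action S ?I)"
    unfolding faithful_action_def by (metis singleton_inject)
  with I have "\<exists>k. ?P k"
    by blast
  then have "?P (deg_rc S)"
    unfolding deg_rc_def by (rule LeastI_ex)
  then obtain \<sigma> where \<sigma>: "right_congruence S \<sigma>"
    "faithful_action S (carrier S // \<sigma>) (quotient_action S \<sigma>)"
    and k: "deg_rc S = card (carrier S // \<sigma>)"
    by blast
  have finX: "finite (carrier S // \<sigma>)"
    using \<sigma>(1) fin by (auto simp: right_congruence_def equiv_def intro: finite_quotient)
  \<comment> \<open>\<open>deg\<close> only admits \<open>m \<ge> 1\<close>; the class of the
    identity makes the quotient nonempty.\<close>
  moreover have "carrier S // \<sigma> \<noteq> {}"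
    using one_closed by blast
  ultimately have "1 \<le> deg_rc S"
    unfolding k by (simp add: Suc_le_eq card_gt_0_iff)
  moreover obtain f where "f \<in> mon S (full_transformation_monoid (deg_rc S))"
    using faithful_right_congruence_imp_mon[OF S \<sigma> finX] k by auto
  ultimately show ?thesis
    unfolding deg_def by (blast intro: Least_le)
qed

text \<open>Identify elements that move the generator \<open>x\<close> to the same point. The
  classes then correspond to points of the orbit of \<open>x\<close>, so there are at most
  \<open>card X\<close> of them, and any point at which \<open>a\<close> and \<open>b\<close> differ
  yields a class at which they differ.\<close>

lemma deg_rc_le_card_of_action:
  assumes S: "monoid S" and fin: "finite X"
    and act: "right_action S X \<mu>" and faithful: "faithful_action S X \<mu>"
    and monogenic: "monogenic_action S X \<mu>"
  shows "deg_rc S \<le> card X"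
proof -
  interpret monoid S by (fact S)
  obtain x where x: "x \<in> X" and X: "X = {x} \<union> {\<mu> x a | a. a \<in> carrier S}"
    using monogenic unfolding monogenic_action_def by blast
  have closed: "\<mu> y a \<in> X" if "y \<in> X" "a \<in> carrier S" for y a
    using act that unfolding right_action_def by blast
  have comp: "\<mu> (\<mu> y a) b = \<mu> y (a \<otimes>\<^bsub>S\<^esub> b)"
    if "y \<in> X" "a \<in> carrier S" "b \<in> carrier S" for y a b
    using act that unfolding right_action_def by blast
  define \<sigma> where "\<sigma> = {(a, b). a \<in> carrier S \<and> b \<in> carrier S \<and> \<mu> x a = \<mu> x b}"
  have eq: "equiv (carrier S) \<sigma>"
    by (rule equivI) (auto simp: \<sigma>_def refl_on_def sym_def trans_def)
  have \<sigma>: "right_congruence S \<sigma>"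
    unfolding right_congruence_def
  proof (intro conjI eq allI impI ballI)
    fix a b s assume "(a, b) \<in> \<sigma>" and s: "s \<in> carrier S"
    then have ab: "a \<in> carrier S" "b \<in> carrier S" "\<mu> x a = \<mu> x b"
      by (auto simp: \<sigma>_def)
    then have "\<mu> x (a \<otimes>\<^bsub>S\<^esub> s) = \<mu> x (b \<otimes>\<^bsub>S\<^esub> s)"
      using comp[OF x] s by metis
    then show "(a \<otimes>\<^bsub>S\<^esub> s, b \<otimes>\<^bsub>S\<^esub> s) \<in> \<sigma>"
      using ab s by (simp add: \<sigma>_def)
  qed
  have "faithful_action S (carrier S // \<sigma>) (quotient_action S \<sigma>)"
    unfolding faithful_action_def
  proof (intro ballI impI)
    fix a b assume ab: "a \<in> carrier S" "b \<in> carrier S" "a \<noteq> b"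
    then obtain y where y: "y \<in> X" "\<mu> y a \<noteq> \<mu> y b"
      using faithful unfolding faithful_action_def by blast
    have "\<exists>c\<in>carrier S. \<mu> x (c \<otimes>\<^bsub>S\<^esub> a) \<noteq> \<mu> x (c \<otimes>\<^bsub>S\<^esub> b)"
    proof (cases "y = x")
      \<comment> \<open>The generator may lie outside its own orbit and may be moved by the
        identity. Still \<one> \<otimes> a = a, so the identity separates \<open>a\<close> from
        \<open>b\<close> here.\<close>
      case True
      then show ?thesis
        using y ab by (intro bexI[of _ "\<one>\<^bsub>S\<^esub>"]) auto
    next
      case False
      then show ?thesis
        using X y comp[OF x] ab by force
    qed
    then obtain c where c: "c \<in> carrier S" "\<mu> x (c \<otimes>\<^bsub>S\<^esub> a) \<noteq> \<mu> x (c \<otimes>\<^bsub>S\<^esub> b)"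
      by blast
    then have "(c \<otimes>\<^bsub>S\<^esub> a, c \<otimes>\<^bsub>S\<^esub> b) \<notin> \<sigma>"
      by (simp add: \<sigma>_def)
    then have "\<sigma> `` {c \<otimes>\<^bsub>S\<^esub> a} \<noteq> \<sigma> `` {c \<otimes>\<^bsub>S\<^esub> b}"
      using eq_equiv_class[OF _ eq] c ab by blast
    then show "\<exists>A\<in>carrier S // \<sigma>. quotient_action S \<sigma> A a \<noteq> quotient_action S \<sigma> A b"
      using c(1) ab
      by (intro bexI[of _ "\<sigma> `` {c}"]) (simp_all add: quotient_action_class[OF \<sigma>] quotientI)
  qed
  then have "deg_rc S \<le> card (carrier S // \<sigma>)"
    unfolding deg_rc_def using \<sigma> by (blast intro: Least_le)
  also have "\<dots> \<le> card X"
  proof (rule card_inj_on_le[OF _ _ fin])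
    let ?r = "\<lambda>A. \<mu> x (SOME a. a \<in> A)"
    have some: "(SOME a. a \<in> A) \<in> A" if "A \<in> carrier S // \<sigma>" for A
      using in_quotient_imp_non_empty[OF eq that] by (simp add: some_in_eq)
    show "inj_on ?r (carrier S // \<sigma>)"
    proof (rule inj_onI)
      fix A B assume A: "A \<in> carrier S // \<sigma>" and B: "B \<in> carrier S // \<sigma>" and r: "?r A = ?r B"
      have "(SOME a. a \<in> A) \<in> carrier S" "(SOME a. a \<in> B) \<in> carrier S"
        using some[OF A] some[OF B] in_quotient_imp_subset[OF eq] A B by blast+
      then show "A = B"
        using r quotient_eqI[OF eq A B some[OF A] some[OF B]] by (simp add: \<sigma>_def)
    qed
    show "?r ` (carrier S // \<sigma>) \<subseteq> X"
      using some in_quotient_imp_subset[OF eq] closed[OF x] by blast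
  qed
  finally show ?thesis .
qed

section \<open>Unions of blocks\<close>

definition linked :: "diagram \<Rightarrow> vertex \<Rightarrow> vertex \<Rightarrow> bool" where
  "linked \<alpha> u v \<longleftrightarrow> (\<exists>B\<in>\<alpha>. u \<in> B \<and> v \<in> B)"

definition join :: "nat set \<Rightarrow> nat set \<Rightarrow> vertex set" where
  "join F G = Up ` F \<union> Lo ` G"

text \<open>Over the field with two elements this is a linear relation between two copies of the
  space of subsets, with \<open>sym_diff\<close> as addition and \<open>({}, {})\<close> as
  zero.\<close>

definition inv_rel :: "nat \<Rightarrow> diagram \<Rightarrow> (nat set \<times> nat set) set" where
  "inv_rel n \<alpha> = {(F, G). F \<subseteq> {1..n} \<and> G \<subseteq> {1..n} \<and>
     (\<forall>u v. linked \<alpha> u v \<longrightarrow> (u \<in> join F G \<longleftrightarrow> v \<in> join F G))}"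

lemma join_iff [simp]:
  "Up x \<in> join F G \<longleftrightarrow> x \<in> F" "Lo x \<in> join F G \<longleftrightarrow> x \<in> G" "Mid x \<notin> join F G"
  by (auto simp: join_def)

lemma verts_iff [simp]:
  "Up x \<in> verts n \<longleftrightarrow> x \<in> {1..n}" "Lo x \<in> verts n \<longleftrightarrow> x \<in> {1..n}" "Mid x \<notin> verts n"
  by (auto simp: verts_def upper_def lower_def)

lemma vertsE:
  assumes "u \<in> verts n"
  obtains x where "u = Up x" "x \<in> {1..n}" | x where "u = Lo x" "x \<in> {1..n}"
  using assms by (auto simp: verts_def upper_def lower_def)

lemma finite_verts [simp]: "finite (verts n)"
  by (simp add: verts_def upper_def lower_def)

lemma finite_partitions [simp]: "finite (partitions n)"
  unfolding partitions_def by (rule finitely_many_partition_on) simp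

lemma linked_sym: "linked \<alpha> u v \<longleftrightarrow> linked \<alpha> v u"
  by (auto simp: linked_def)

lemma linked_symD: "linked \<alpha> u v \<Longrightarrow> linked \<alpha> v u"
  by (auto simp: linked_def)

lemma linked_refl: "\<alpha> \<in> partitions n \<Longrightarrow> linked \<alpha> u u \<longleftrightarrow> u \<in> verts n"
  by (auto simp: linked_def partitions_def partition_on_def)

lemma linked_verts: "\<alpha> \<in> partitions n \<Longrightarrow> linked \<alpha> u v \<Longrightarrow> u \<in> verts n \<and> v \<in> verts n"
  by (auto simp: linked_def partitions_def partition_on_def)

lemma blocks_eq:
  "\<alpha> \<in> partitions n \<Longrightarrow> A \<in> \<alpha> \<Longrightarrow> B \<in> \<alpha> \<Longrightarrow> u \<in> A \<Longrightarrow> u \<in> B \<Longrightarrow> A = B"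
  by (auto simp: partitions_def partition_on_def disjoint_def)

lemma linked_blockD:
  "\<alpha> \<in> partitions n \<Longrightarrow> linked \<alpha> u v \<Longrightarrow> B \<in> \<alpha> \<Longrightarrow> u \<in> B \<Longrightarrow> v \<in> B"
  unfolding linked_def using blocks_eq[of \<alpha> n] by blast

lemma linked_trans:
  "\<alpha> \<in> partitions n \<Longrightarrow> linked \<alpha> u v \<Longrightarrow> linked \<alpha> v w \<Longrightarrow> linked \<alpha> u w"
  unfolding linked_def using blocks_eq[of \<alpha> n] by blast

lemma partitions_eqI:
  assumes "\<alpha> \<in> partitions n" "\<beta> \<in> partitions n" "\<And>u v. linked \<alpha> u v \<longleftrightarrow> linked \<beta> u v"
  shows "\<alpha> = \<beta>"
proof -
  have "verts n // {(u, v). linked \<gamma> u v} = \<gamma>" if "\<gamma> \<in> partitions n" for \<gamma>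
    using partition_on_eq_quotient[of "verts n" \<gamma>] that by (simp add: linked_def partitions_def)
  moreover have "{(u, v). linked \<alpha> u v} = {(u, v). linked \<beta> u v}"
    by (simp only: assms(3))
  ultimately show ?thesis
    using assms(1,2) by metis
qed

text \<open>The block of \<open>u\<close>, split into its two rows, is the test set used whenever an
  invariant set containing \<open>u\<close> and as little else as possible is needed.\<close>

lemma linked_block:
  assumes "\<alpha> \<in> partitions n"
  shows "({x. linked \<alpha> u (Up x)}, {y. linked \<alpha> u (Lo y)}) \<in> inv_rel n \<alpha>"
    and "v \<in> verts n \<Longrightarrow>
      v \<in> join {x. linked \<alpha> u (Up x)} {y. linked \<alpha> u (Lo y)} \<longleftrightarrow> linked \<alpha> u v"
proof -
  let ?J = "join {x. linked \<alpha> u (Up x)} {y. linked \<alpha> u (Lo y)}"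
  have J: "v \<in> ?J \<longleftrightarrow> linked \<alpha> u v" if "v \<in> verts n" for v
    using that by (cases v) auto
  then show "v \<in> verts n \<Longrightarrow> v \<in> ?J \<longleftrightarrow> linked \<alpha> u v" .
  have "v \<in> ?J \<longleftrightarrow> w \<in> ?J" if "linked \<alpha> v w" for v w
    using J linked_verts[OF assms that] linked_trans[OF assms _ that]
      linked_trans[OF assms _ linked_symD[OF that]] by blast
  moreover have "{x. linked \<alpha> u (Up x)} \<subseteq> {1..n}" "{y. linked \<alpha> u (Lo y)} \<subseteq> {1..n}"
    using linked_verts[OF assms] by fastforce+
  ultimately show "({x. linked \<alpha> u (Up x)}, {y. linked \<alpha> u (Lo y)}) \<in> inv_rel n \<alpha>"
    unfolding inv_rel_def by blast
qed

text \<open>The block of \<open>u\<close> separates \<open>u\<close> from every vertex outside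
  it.\<close>

lemma linked_iff_inv_rel:
  assumes "\<alpha> \<in> partitions n" "u \<in> verts n" "v \<in> verts n"
  shows "linked \<alpha> u v \<longleftrightarrow> (\<forall>F G. (F, G) \<in> inv_rel n \<alpha> \<longrightarrow> (u \<in> join F G \<longleftrightarrow> v \<in> join F G))"
proof
  assume R: "\<forall>F G. (F, G) \<in> inv_rel n \<alpha> \<longrightarrow> (u \<in> join F G \<longleftrightarrow> v \<in> join F G)"
  show "linked \<alpha> u v"
    using R[rule_format, OF linked_block(1)[OF assms(1), of u]] linked_block(2)[OF assms(1)]
      assms linked_refl by blast
qed (auto simp: inv_rel_def)

lemma inv_rel_inject:
  assumes "\<alpha> \<in> partitions n" "\<beta> \<in> partitions n" "inv_rel n \<alpha> = inv_rel n \<beta>"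
  shows "\<alpha> = \<beta>"
proof (rule partitions_eqI[OF assms(1,2)])
  fix u v
  show "linked \<alpha> u v \<longleftrightarrow> linked \<beta> u v"
    using linked_iff_inv_rel[OF assms(1), of u v] linked_iff_inv_rel[OF assms(2), of u v]
      linked_verts[OF assms(1), of u v] linked_verts[OF assms(2), of u v] assms(3) by metis
qed

lemma inv_rel_subset: "(F, G) \<in> inv_rel n \<alpha> \<Longrightarrow> F \<subseteq> {1..n} \<and> G \<subseteq> {1..n}"
  by (simp add: inv_rel_def)

lemma inv_relD: "(F, G) \<in> inv_rel n \<alpha> \<Longrightarrow> linked \<alpha> u v \<Longrightarrow> u \<in> join F G \<longleftrightarrow> v \<in> join F G"
  by (simp add: inv_rel_def)

text \<open>One implication suffices, since \<open>linked\<close> is symmetric.\<close>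

lemma inv_relI:
  assumes "F \<subseteq> {1..n}" "G \<subseteq> {1..n}"
    "\<And>u v. linked \<alpha> u v \<Longrightarrow> u \<in> join F G \<Longrightarrow> v \<in> join F G"
  shows "(F, G) \<in> inv_rel n \<alpha>"
  using assms linked_symD[of \<alpha>] unfolding inv_rel_def by blast

lemma inv_rel_empty: "({}, {}) \<in> inv_rel n \<alpha>"
  by (rule inv_relI) (auto simp: join_def)

lemma inv_rel_full: "\<alpha> \<in> partitions n \<Longrightarrow> ({1..n}, {1..n}) \<in> inv_rel n \<alpha>"
  by (rule inv_relI) (auto dest!: linked_verts elim!: vertsE)

lemma inv_rel_sym_diff:
  assumes "(F, G) \<in> inv_rel n \<alpha>" "(F', G') \<in> inv_rel n \<alpha>"
  shows "(sym_diff F F', sym_diff G G') \<in> inv_rel n \<alpha>"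
proof (rule inv_relI)
  have "u \<in> join (sym_diff F F') (sym_diff G G') \<longleftrightarrow> (u \<in> join F G \<longleftrightarrow> u \<notin> join F' G')" for u
    by (cases u) auto
  then show "v \<in> join (sym_diff F F') (sym_diff G G')"
    if "linked \<alpha> u v" "u \<in> join (sym_diff F F') (sym_diff G G')" for u v
    using assms[THEN inv_relD, OF that(1)] that(2) by blast
  show "sym_diff F F' \<subseteq> {1..n}" "sym_diff G G' \<subseteq> {1..n}"
    using assms[THEN inv_rel_subset] by (simp_all add: le_supI Diff_subset_conv le_supI2)
qed

subsection \<open>Products\<close>

lemma stacked_equiv_sym: "(u, v) \<in> stacked_equiv \<alpha> \<beta> \<Longrightarrow> (v, u) \<in> stacked_equiv \<alpha> \<beta>"
proof -
  have "sym (stacked_equiv \<alpha> \<beta>)"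
    unfolding stacked_equiv_def by (rule sym_trancl) (auto simp: sym_def)
  then show "(u, v) \<in> stacked_equiv \<alpha> \<beta> \<Longrightarrow> (v, u) \<in> stacked_equiv \<alpha> \<beta>"
    by (auto simp: sym_def)
qed

lemma stacked_equiv_trans:
  "(u, v) \<in> stacked_equiv \<alpha> \<beta> \<Longrightarrow> (v, w) \<in> stacked_equiv \<alpha> \<beta> \<Longrightarrow> (u, w) \<in> stacked_equiv \<alpha> \<beta>"
  unfolding stacked_equiv_def by (rule trancl_trans)

lemma stacked_equiv_upper: "linked \<alpha> u v \<Longrightarrow> (lo_to_mid u, lo_to_mid v) \<in> stacked_equiv \<alpha> \<beta>"
  unfolding stacked_equiv_def stacked_blocks_def linked_def by (blast intro: r_into_trancl)

lemma stacked_equiv_lower: "linked \<beta> u v \<Longrightarrow> (up_to_mid u, up_to_mid v) \<in> stacked_equiv \<alpha> \<beta>"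
  unfolding stacked_equiv_def stacked_blocks_def linked_def by (blast intro: r_into_trancl)

lemma stacked_equiv_induct [consumes 1, case_names refl upper lower]:
  assumes uv: "(u, v) \<in> stacked_equiv \<alpha> \<beta>"
    and refl: "P u"
    and upper: "\<And>w z. linked \<alpha> w z \<Longrightarrow> P (lo_to_mid w) \<Longrightarrow> P (lo_to_mid z)"
    and lower: "\<And>w z. linked \<beta> w z \<Longrightarrow> P (up_to_mid w) \<Longrightarrow> P (up_to_mid z)"
  shows "P v"
proof -
  have step: "P z" if wz: "(w, z) \<in> (\<Union>C\<in>stacked_blocks \<alpha> \<beta>. C \<times> C)" and "P w" for w z
  proof -
    obtain C where C: "C \<in> stacked_blocks \<alpha> \<beta>" "w \<in> C" "z \<in> C"
      using wz by blast
    then consider B where "B \<in> \<alpha>" "C = lo_to_mid ` B" | B where "B \<in> \<beta>" "C = up_to_mid ` B"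
      unfolding stacked_blocks_def by blast
    then show ?thesis
    proof cases
      case 1
      then show ?thesis
        using C upper \<open>P w\<close> unfolding linked_def by blast
    next
      case 2
      then show ?thesis
        using C lower \<open>P w\<close> unfolding linked_def by blast
    qed
  qed
  show ?thesis
    using uv unfolding stacked_equiv_def by (induction rule: trancl_induct) (auto intro: step refl)
qed

lemma stacked_equiv_refl:
  assumes "\<alpha> \<in> partitions n" "\<beta> \<in> partitions n" "u \<in> verts n"
  shows "(u, u) \<in> stacked_equiv \<alpha> \<beta>"
  using assms(3)
proof (cases rule: vertsE)
  case (1 x)
  then show ?thesis
    using stacked_equiv_upper[of \<alpha> u u] linked_refl[OF assms(1)] assms(3) by simp
next
  case (2 x)
  then show ?thesis
    using stacked_equiv_lower[of \<beta> u u] linked_refl[OF assms(2)] assms(3) by simp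
qed

lemma
  assumes "\<alpha> \<in> partitions n" "\<beta> \<in> partitions n"
  shows diagram_mult_partitions: "diagram_mult n \<alpha> \<beta> \<in> partitions n"
    and linked_diagram_mult: "linked (diagram_mult n \<alpha> \<beta>) u v \<longleftrightarrow>
      u \<in> verts n \<and> v \<in> verts n \<and> (u, v) \<in> stacked_equiv \<alpha> \<beta>"
proof -
  let ?r = "stacked_equiv \<alpha> \<beta> \<inter> verts n \<times> verts n"
  have eq: "equiv (verts n) ?r"
  proof (rule equivI)
    show "refl_on (verts n) ?r"
      using stacked_equiv_refl[OF assms] by (simp add: refl_on_def)
    show "sym ?r"
      by (rule symI) (blast dest: stacked_equiv_sym)
    show "trans ?r"
      by (rule transI) (blast dest: stacked_equiv_trans)
  qed blast
  then show "diagram_mult n \<alpha> \<beta> \<in> partitions n"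
    unfolding diagram_mult_def partitions_def by (simp add: partition_on_quotient)
  have "(u, v) \<in> ?r" if "A \<in> verts n // ?r" "u \<in> A" "v \<in> A" for A
    using in_quotient_imp_in_rel[OF eq, of A u v] that by simp
  moreover have "\<exists>A\<in>verts n // ?r. u \<in> A \<and> v \<in> A" if "(u, v) \<in> ?r"
    using that stacked_equiv_refl[OF assms, of u] by (intro bexI[of _ "?r `` {u}"] quotientI) auto
  ultimately show "linked (diagram_mult n \<alpha> \<beta>) u v \<longleftrightarrow>
      u \<in> verts n \<and> v \<in> verts n \<and> (u, v) \<in> stacked_equiv \<alpha> \<beta>"
    unfolding linked_def diagram_mult_def by blast
qed

text \<open>An invariant set of the product is saturated in the stacked diagram; \<psi> is the
  saturation and its trace on the middle row is the linking set \<open>G\<close>. Conversely,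
  \<open>F\<close>, \<open>G\<close> and \<open>H\<close> placed on the three rows form a set that
  is invariant under the blocks of both factors, hence under the equivalence they generate.\<close>

lemma inv_rel_diagram_mult:
  assumes \<alpha>: "\<alpha> \<in> partitions n" and \<beta>: "\<beta> \<in> partitions n"
  shows "inv_rel n (diagram_mult n \<alpha> \<beta>) = inv_rel n \<alpha> O inv_rel n \<beta>"
proof (intro equalityI subrelI)
  fix F H assume FH: "(F, H) \<in> inv_rel n (diagram_mult n \<alpha> \<beta>)"
  define \<psi> where "\<psi> w \<longleftrightarrow> (\<exists>u\<in>verts n. u \<in> join F H \<and> (u, w) \<in> stacked_equiv \<alpha> \<beta>)" for w
  have \<psi>: "\<psi> w \<longleftrightarrow> w \<in> join F H" if "w \<in> verts n" for w
  proof
    assume "\<psi> w"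
    then obtain u where u: "u \<in> verts n" "u \<in> join F H" "(u, w) \<in> stacked_equiv \<alpha> \<beta>"
      unfolding \<psi>_def by blast
    then have "linked (diagram_mult n \<alpha> \<beta>) u w"
      using that by (simp add: linked_diagram_mult[OF \<alpha> \<beta>])
    then show "w \<in> join F H"
      using inv_relD[OF FH] u(2) by blast
  next
    assume "w \<in> join F H"
    then show "\<psi> w"
      using that stacked_equiv_refl[OF \<alpha> \<beta> that] unfolding \<psi>_def by blast
  qed
  have \<psi>_cong: "\<psi> z" if "(w, z) \<in> stacked_equiv \<alpha> \<beta>" "\<psi> w" for w z
    using that unfolding \<psi>_def by (blast dest: stacked_equiv_trans)
  define G where "G = {m \<in> {1..n}. \<psi> (Mid m)}"
  have up: "u \<in> join F G \<longleftrightarrow> \<psi> (lo_to_mid u)" if "u \<in> verts n" for u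
    using that \<psi>[of u] by (cases u) (auto simp: G_def)
  have lo: "u \<in> join G H \<longleftrightarrow> \<psi> (up_to_mid u)" if "u \<in> verts n" for u
    using that \<psi>[of u] by (cases u) (auto simp: G_def)
  have "(F, G) \<in> inv_rel n \<alpha>"
  proof (rule inv_relI)
    fix u v assume "linked \<alpha> u v" "u \<in> join F G"
    then show "v \<in> join F G"
      using up linked_verts[OF \<alpha>, of u v] \<psi>_cong[OF stacked_equiv_upper, of u v] by simp
  qed (use inv_rel_subset[OF FH] in \<open>auto simp: G_def\<close>)
  moreover have "(G, H) \<in> inv_rel n \<beta>"
  proof (rule inv_relI)
    fix u v assume "linked \<beta> u v" "u \<in> join G H"
    then show "v \<in> join G H"
      using lo linked_verts[OF \<beta>, of u v] \<psi>_cong[OF stacked_equiv_lower, of u v] by simp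
  qed (use inv_rel_subset[OF FH] in \<open>auto simp: G_def\<close>)
  ultimately show "(F, H) \<in> inv_rel n \<alpha> O inv_rel n \<beta>"
    by blast
next
  fix F H assume "(F, H) \<in> inv_rel n \<alpha> O inv_rel n \<beta>"
  then obtain G where FG: "(F, G) \<in> inv_rel n \<alpha>" and GH: "(G, H) \<in> inv_rel n \<beta>"
    by blast
  let ?\<phi> = "\<lambda>w. w \<in> join F H \<or> w \<in> Mid ` G"
  have up: "?\<phi> (lo_to_mid w) \<longleftrightarrow> w \<in> join F G" if "linked \<alpha> w z" for w z
    using linked_verts[OF \<alpha> that] by (cases w) auto
  have lo: "?\<phi> (up_to_mid w) \<longleftrightarrow> w \<in> join G H" if "linked \<beta> w z" for w z
    using linked_verts[OF \<beta> that] by (cases w) auto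
  have "?\<phi> v" if "(u, v) \<in> stacked_equiv \<alpha> \<beta>" "?\<phi> u" for u v
    using that
  proof (induction rule: stacked_equiv_induct)
    case (upper w z)
    then show ?case
      using up[OF upper(1)] up[OF linked_symD[OF upper(1)]] inv_relD[OF FG upper(1)] by simp
  next
    case (lower w z)
    then show ?case
      using lo[OF lower(1)] lo[OF linked_symD[OF lower(1)]] inv_relD[OF GH lower(1)] by simp
  qed
  note * = this
  show "(F, H) \<in> inv_rel n (diagram_mult n \<alpha> \<beta>)"
  proof (rule inv_relI)
    fix u v assume "linked (diagram_mult n \<alpha> \<beta>) u v" "u \<in> join F H"
    then show "v \<in> join F H"
      using *[of u v] by (auto simp: linked_diagram_mult[OF \<alpha> \<beta>])
  qed (use inv_rel_subset[OF FG] inv_rel_subset[OF GH] in simp_all)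
qed

lemma diagram_mult_assoc:
  assumes "\<alpha> \<in> partitions n" "\<beta> \<in> partitions n" "\<gamma> \<in> partitions n"
  shows "diagram_mult n (diagram_mult n \<alpha> \<beta>) \<gamma> = diagram_mult n \<alpha> (diagram_mult n \<beta> \<gamma>)"
  by (rule inv_rel_inject[of _ n])
    (simp_all add: assms diagram_mult_partitions inv_rel_diagram_mult O_assoc)

subsection \<open>The involution\<close>

lemma flip_flip [simp]: "flip (flip u) = u"
  by (cases u) auto

lemma inj_flip: "inj flip"
  by (metis flip_flip injI)

lemma flip_verts [simp]: "flip u \<in> verts n \<longleftrightarrow> u \<in> verts n"
  by (cases u) auto

lemma flip_join [simp]: "flip u \<in> join F G \<longleftrightarrow> u \<in> join G F"
  by (cases u) auto

lemma linked_star: "linked (star \<alpha>) u v \<longleftrightarrow> linked \<alpha> (flip u) (flip v)"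
proof -
  have "u \<in> flip ` B \<longleftrightarrow> flip u \<in> B" for u B
    by (metis flip_flip image_iff)
  then show ?thesis
    by (simp add: linked_def star_def)
qed

lemma star_partitions: "\<alpha> \<in> partitions n \<Longrightarrow> star \<alpha> \<in> partitions n"
proof -
  assume \<alpha>: "\<alpha> \<in> partitions n"
  have "flip ` verts n = verts n"
    by (metis flip_flip flip_verts image_eqI subsetI subset_antisym image_subset_iff)
  moreover have "{} \<notin> \<alpha>"
    using \<alpha> by (simp add: partitions_def partition_on_def)
  moreover have "(`) flip ` \<alpha> - {{}} = (`) flip ` \<alpha>"
    using \<open>{} \<notin> \<alpha>\<close> by auto
  ultimately show ?thesis
    using partition_on_inj_image[of "verts n" \<alpha> flip] \<alpha> inj_on_subset[OF inj_flip]
    by (simp add: partitions_def star_def)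
qed

lemma inv_rel_star: "inv_rel n (star \<alpha>) = (inv_rel n \<alpha>)\<inverse>"
proof (unfold set_eq_iff split_paired_All, intro allI)
  fix F G
  have "(\<forall>u v. linked \<alpha> (flip u) (flip v) \<longrightarrow> (u \<in> join F G \<longleftrightarrow> v \<in> join F G)) \<longleftrightarrow>
    (\<forall>u v. linked \<alpha> u v \<longrightarrow> (u \<in> join G F \<longleftrightarrow> v \<in> join G F))" (is "?L \<longleftrightarrow> ?R")
  proof
    assume ?L
    show ?R
    proof (intro allI impI)
      fix u v assume "linked \<alpha> u v"
      then show "u \<in> join G F \<longleftrightarrow> v \<in> join G F"
        using \<open>?L\<close>[rule_format, of "flip u" "flip v"] by simp
    qed
  next
    assume ?R
    then show ?L
      by (metis flip_join)
  qed
  then show "(F, G) \<in> inv_rel n (star \<alpha>) \<longleftrightarrow> (F, G) \<in> (inv_rel n \<alpha>)\<inverse>"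
    by (auto simp: inv_rel_def linked_star)
qed

lemma star_star [simp]: "star (star \<alpha>) = \<alpha>"
  by (simp add: star_def image_image)

lemma star_diagram_mult:
  assumes "\<alpha> \<in> partitions n" "\<beta> \<in> partitions n"
  shows "star (diagram_mult n \<alpha> \<beta>) = diagram_mult n (star \<beta>) (star \<alpha>)"
  by (rule inv_rel_inject[of _ n])
    (simp_all add: assms star_partitions diagram_mult_partitions inv_rel_diagram_mult inv_rel_star
      converse_relcomp)

lemma diagram_mult_star_mult:
  assumes \<alpha>: "\<alpha> \<in> partitions n"
  shows "diagram_mult n (diagram_mult n \<alpha> (star \<alpha>)) \<alpha> = \<alpha>"
proof (rule inv_rel_inject[of _ n])
  \<comment> \<open>Adding the three pairs cancels \<open>K\<close> and \<open>H\<close>. The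
    reverse inclusion takes \<open>K = F\<close> and \<open>H = G\<close>.\<close>
  have "(F, G) \<in> inv_rel n \<alpha>"
    if "(F, H) \<in> inv_rel n \<alpha>" "(K, H) \<in> inv_rel n \<alpha>" "(K, G) \<in> inv_rel n \<alpha>" for F G H K
  proof -
    have "sym_diff (sym_diff F K) K = F" "sym_diff (sym_diff H H) G = G"
      by auto
    then show ?thesis
      using inv_rel_sym_diff[OF inv_rel_sym_diff[OF that(1,2)] that(3)] by simp
  qed
  then show "inv_rel n (diagram_mult n (diagram_mult n \<alpha> (star \<alpha>)) \<alpha>) = inv_rel n \<alpha>"
    by (auto simp: inv_rel_diagram_mult inv_rel_star \<alpha> star_partitions diagram_mult_partitions)
qed (simp_all add: \<alpha> star_partitions diagram_mult_partitions)

subsection \<open>Kernel and rank\<close>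

lemma ker_iff: "(x, y) \<in> ker \<alpha> \<longleftrightarrow> linked \<alpha> (Up x) (Up y)"
  by (simp add: ker_def linked_def)

text \<open>A kernel-saturated set is completed to an invariant one by the lower vertices linked to
  it.\<close>

lemma Domain_inv_rel:
  assumes \<alpha>: "\<alpha> \<in> partitions n"
  shows "F \<in> Domain (inv_rel n \<alpha>) \<longleftrightarrow> F \<subseteq> {1..n} \<and> (\<forall>(x, y)\<in>ker \<alpha>. x \<in> F \<longrightarrow> y \<in> F)"
proof
  assume "F \<in> Domain (inv_rel n \<alpha>)"
  then obtain G where "(F, G) \<in> inv_rel n \<alpha>"
    by blast
  then show "F \<subseteq> {1..n} \<and> (\<forall>(x, y)\<in>ker \<alpha>. x \<in> F \<longrightarrow> y \<in> F)"
    using inv_relD[of F G n \<alpha> "Up _" "Up _"] inv_rel_subset by (auto simp: ker_iff)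
next
  assume F: "F \<subseteq> {1..n} \<and> (\<forall>(x, y)\<in>ker \<alpha>. x \<in> F \<longrightarrow> y \<in> F)"
  define G where "G = {y. \<exists>x\<in>F. linked \<alpha> (Up x) (Lo y)}"
  have J: "u \<in> join F G \<longleftrightarrow> (\<exists>x\<in>F. linked \<alpha> (Up x) u)" if "u \<in> verts n" for u
    using that F linked_refl[OF \<alpha>, of u] by (cases u) (auto simp: G_def ker_iff)
  have "(F, G) \<in> inv_rel n \<alpha>"
  proof (rule inv_relI)
    show "G \<subseteq> {1..n}"
      using linked_verts[OF \<alpha>, of "Up _" "Lo _"] by (fastforce simp: G_def)
    show "v \<in> join F G" if "linked \<alpha> u v" "u \<in> join F G" for u v
      using J linked_verts[OF \<alpha> that(1)] linked_trans[OF \<alpha>] that by blast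
  qed (use F in blast)
  then show "F \<in> Domain (inv_rel n \<alpha>)"
    by blast
qed

lemma ker_iff_Domain:
  assumes \<alpha>: "\<alpha> \<in> partitions n"
  shows "(x, y) \<in> ker \<alpha> \<longleftrightarrow>
    x \<in> {1..n} \<and> y \<in> {1..n} \<and> (\<forall>F\<in>Domain (inv_rel n \<alpha>). x \<in> F \<longleftrightarrow> y \<in> F)"
proof
  assume "(x, y) \<in> ker \<alpha>"
  then show "x \<in> {1..n} \<and> y \<in> {1..n} \<and> (\<forall>F\<in>Domain (inv_rel n \<alpha>). x \<in> F \<longleftrightarrow> y \<in> F)"
    using linked_verts[OF \<alpha>, of "Up x" "Up y"] inv_relD[of _ _ n \<alpha> "Up x" "Up y"]
    by (auto simp: ker_iff)
next
  assume r: "x \<in> {1..n} \<and> y \<in> {1..n} \<and> (\<forall>F\<in>Domain (inv_rel n \<alpha>). x \<in> F \<longleftrightarrow> y \<in> F)"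
  have "{z. linked \<alpha> (Up x) (Up z)} \<in> Domain (inv_rel n \<alpha>)"
    by (rule DomainI[OF linked_block(1)[OF \<alpha>]])
  from r[THEN conjunct2, THEN conjunct2, rule_format, OF this]
  show "(x, y) \<in> ker \<alpha>"
    using r linked_refl[OF \<alpha>, of "Up x"] by (simp add: ker_iff)
qed

lemma ker_eq_iff_Domain:
  assumes "\<alpha> \<in> partitions n" "\<beta> \<in> partitions n"
  shows "ker \<alpha> = ker \<beta> \<longleftrightarrow> Domain (inv_rel n \<alpha>) = Domain (inv_rel n \<beta>)"
proof
  assume eq: "ker \<alpha> = ker \<beta>"
  show "Domain (inv_rel n \<alpha>) = Domain (inv_rel n \<beta>)"
    by (rule Set.set_eqI) (simp only: Domain_inv_rel[OF assms(1)] Domain_inv_rel[OF assms(2)] eq)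
next
  assume eq: "Domain (inv_rel n \<alpha>) = Domain (inv_rel n \<beta>)"
  have "(x, y) \<in> ker \<alpha> \<longleftrightarrow> (x, y) \<in> ker \<beta>" for x y
    by (simp only: ker_iff_Domain[OF assms(1)] ker_iff_Domain[OF assms(2)] eq)
  then show "ker \<alpha> = ker \<beta>"
    by (simp only: set_eq_iff split_paired_All simp_thms)
qed

text \<open>The domain of a composite is the preimage of the domain of its right factor.\<close>

lemma ker_mult_left_cong:
  assumes "\<gamma> \<in> partitions n" "\<alpha> \<in> partitions n" "\<beta> \<in> partitions n" "ker \<alpha> = ker \<beta>"
  shows "ker (diagram_mult n \<gamma> \<alpha>) = ker (diagram_mult n \<gamma> \<beta>)"
proof -
  have "Domain (inv_rel n \<alpha>) = Domain (inv_rel n \<beta>)"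
    using assms ker_eq_iff_Domain by blast
  then have "Domain (inv_rel n \<gamma> O inv_rel n \<alpha>) = Domain (inv_rel n \<gamma> O inv_rel n \<beta>)"
    by blast
  then show ?thesis
    using assms by (simp add: ker_eq_iff_Domain[of _ n] diagram_mult_partitions inv_rel_diagram_mult)
qed

text \<open>Upper vertices of the left factor keep their names in the stacked diagram, so links
  between them survive.\<close>

lemma ker_subset_ker_mult:
  assumes "\<alpha> \<in> partitions n" "\<beta> \<in> partitions n"
  shows "ker \<alpha> \<subseteq> ker (diagram_mult n \<alpha> \<beta>)"
  using stacked_equiv_upper[of \<alpha> "Up _" "Up _"] linked_verts[OF assms(1), of "Up _" "Up _"]
  by (auto simp: ker_iff linked_diagram_mult[OF assms])

lemma rank_star: "rank (star \<alpha>) = rank \<alpha>"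
proof -
  let ?T = "\<lambda>\<alpha>. {B \<in> \<alpha>. (\<exists>x. Up x \<in> B) \<and> (\<exists>y. Lo y \<in> B)}"
  have "Up x \<in> flip ` B \<longleftrightarrow> Lo x \<in> B" "Lo x \<in> flip ` B \<longleftrightarrow> Up x \<in> B" for x B
    by (metis flip.simps flip_flip image_iff)+
  then have "?T (star \<alpha>) = image flip ` ?T \<alpha>"
    unfolding star_def by (intro Set.set_eqI iffI) (elim CollectE conjE imageE exE; blast)+
  moreover have "inj_on (image flip) (?T \<alpha>)"
    using inj_flip by (intro inj_onI) (simp add: inj_image_eq_iff)
  ultimately show ?thesis
    unfolding rank_def by (simp only: card_image)
qed

text \<open>Each transversal block of the product shares an upper vertex with some transversal block
  of \<alpha>. Choosing one gives an injection \<open>c\<close>, because the upper part of a block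
  of \<alpha> stays within one block of the product.\<close>

lemma rank_mult_le_left:
  assumes \<alpha>: "\<alpha> \<in> partitions n" and \<beta>: "\<beta> \<in> partitions n"
  shows "rank (diagram_mult n \<alpha> \<beta>) \<le> rank \<alpha>"
proof -
  let ?T = "\<lambda>\<alpha>. {B \<in> \<alpha>. (\<exists>x. Up x \<in> B) \<and> (\<exists>y. Lo y \<in> B)}"
  let ?\<gamma> = "diagram_mult n \<alpha> \<beta>"
  have \<gamma>: "?\<gamma> \<in> partitions n"
    using diagram_mult_partitions[OF \<alpha> \<beta>] .
  have ex: "\<exists>A\<in>?T \<alpha>. \<exists>x. Up x \<in> A \<and> Up x \<in> B" if B: "B \<in> ?T ?\<gamma>" for B
  proof (rule ccontr)
    assume no: "\<not> ?thesis"
    obtain x y where xy: "Up x \<in> B" "Lo y \<in> B"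
      using B by blast
    have xyl: "linked ?\<gamma> (Up x) (Lo y)"
      using B xy by (auto simp: linked_def)
    define F where "F = {z. Up z \<in> B}"
    \<comment> \<open>If there were no such block, \<open>F\<close>, the upper part of
      \<open>B\<close>, would be a union of blocks of \<alpha> without lower vertices. Then
      \<open>(F, {})\<close> is invariant for the product too and cuts \<open>B\<close> between
      \<open>Up x\<close> and \<open>Lo y\<close>.\<close>
    have "(F, {}) \<in> inv_rel n \<alpha>"
    proof (rule inv_relI)
      show "F \<subseteq> {1..n}"
        using B linked_verts[OF \<gamma>, of "Up _" "Up _"] by (fastforce simp: F_def linked_def)
      show "v \<in> join F {}" if uv: "linked \<alpha> u v" "u \<in> join F {}" for u v
      proof -
        obtain z where z: "u = Up z" "Up z \<in> B"
          using uv(2) by (auto simp: join_def F_def)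
        obtain A where A: "A \<in> \<alpha>" "Up z \<in> A" "v \<in> A"
          using uv(1) z by (auto simp: linked_def)
        then obtain w where w: "v = Up w"
          using no z linked_verts[OF \<alpha> uv(1)] by (cases v) auto
        have "linked ?\<gamma> (Up z) (Up w)"
          using uv(1) z w ker_subset_ker_mult[OF \<alpha> \<beta>] by (auto simp: ker_iff subset_iff)
        then have "Up w \<in> B"
          using B z linked_blockD[OF \<gamma>] by blast
        then show ?thesis
          by (simp add: F_def w)
      qed
    qed simp
    then have "(F, {}) \<in> inv_rel n ?\<gamma>"
      using inv_rel_empty unfolding inv_rel_diagram_mult[OF \<alpha> \<beta>] by blast
    then show False
      using inv_relD[OF _ xyl] xy by (auto simp: F_def)
  qed
  define c where "c B = (SOME A. A \<in> ?T \<alpha> \<and> (\<exists>x. Up x \<in> A \<and> Up x \<in> B))" for B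
  have c: "c B \<in> ?T \<alpha>" "\<exists>x. Up x \<in> c B \<and> Up x \<in> B" if "B \<in> ?T ?\<gamma>" for B
    using someI_ex[of "\<lambda>A. A \<in> ?T \<alpha> \<and> (\<exists>x. Up x \<in> A \<and> Up x \<in> B)"] ex[OF that]
    unfolding c_def by blast+
  have "inj_on c (?T ?\<gamma>)"
  proof (rule inj_onI)
    fix B C assume B: "B \<in> ?T ?\<gamma>" and C: "C \<in> ?T ?\<gamma>" and eq: "c B = c C"
    obtain x y where xy: "Up x \<in> c B" "Up x \<in> B" "Up y \<in> c B" "Up y \<in> C"
      using c(2)[OF B] c(2)[OF C] eq by auto
    then have "linked \<alpha> (Up x) (Up y)"
      using c(1)[OF B] by (auto simp: linked_def)
    then have "linked ?\<gamma> (Up x) (Up y)"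
      using ker_subset_ker_mult[OF \<alpha> \<beta>] by (auto simp: ker_iff subset_iff)
    then have "Up y \<in> B"
      using linked_blockD[OF \<gamma>] B xy by blast
    then show "B = C"
      using B C xy blocks_eq[OF \<gamma>, of B C "Up y"] by simp
  qed
  moreover have "finite (?T \<alpha>)"
    using \<alpha> finite_elements[of "verts n" \<alpha>] by (simp add: partitions_def)
  ultimately show ?thesis
    unfolding rank_def using c(1) by (intro card_inj_on_le[of c]) auto
qed

lemma rank_mult_le_right:
  assumes "\<alpha> \<in> partitions n" "\<beta> \<in> partitions n"
  shows "rank (diagram_mult n \<alpha> \<beta>) \<le> rank \<beta>"
  using rank_mult_le_left[of "star \<beta>" n "star \<alpha>"] assms
  by (metis rank_star star_diagram_mult star_partitions)

section \<open>Closure of the partial Brauer monoid\<close>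

text \<open>Blocks of a product are accessible through \<open>linked\<close>, hence this pointwise
  form: a vertex has at most one other partner.\<close>

lemma small_blocks_iff:
  assumes \<alpha>: "\<alpha> \<in> partitions n"
  shows "(\<forall>B\<in>\<alpha>. card B \<le> 2) \<longleftrightarrow>
    (\<forall>u v w. linked \<alpha> u v \<longrightarrow> linked \<alpha> u w \<longrightarrow> u \<noteq> v \<longrightarrow> u \<noteq> w \<longrightarrow> v = w)"
proof (intro iffI allI impI ballI)
  fix u v w
  assume B: "\<forall>B\<in>\<alpha>. card B \<le> 2" and uv: "linked \<alpha> u v" "linked \<alpha> u w" and ne: "u \<noteq> v" "u \<noteq> w"
  obtain A where A: "A \<in> \<alpha>" "u \<in> A" "v \<in> A"
    using uv(1) by (auto simp: linked_def)
  then have "w \<in> A"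
    using linked_blockD[OF \<alpha> uv(2)] by blast
  moreover have "finite A"
    using A(1) \<alpha> finite_subset[OF _ finite_verts[of n], of A]
    by (auto simp: partitions_def partition_on_def)
  ultimately have "card {u, v, w} \<le> 2"
    using card_mono[of A "{u, v, w}"] A B by fastforce
  then show "v = w"
    using ne by (cases "v = w") auto
next
  fix B
  assume R: "\<forall>u v w. linked \<alpha> u v \<longrightarrow> linked \<alpha> u w \<longrightarrow> u \<noteq> v \<longrightarrow> u \<noteq> w \<longrightarrow> v = w" and B: "B \<in> \<alpha>"
  obtain u where u: "u \<in> B"
    using B \<alpha> unfolding partitions_def partition_on_def by (metis (mono_tags) equals0I mem_Collect_eq)
  have "\<exists>v. B \<subseteq> {u, v}"
  proof (cases "B = {u}")
    case False
    then obtain v where "v \<in> B" "v \<noteq> u"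
      using u by blast
    then show ?thesis
      using R u B unfolding linked_def by blast
  qed auto
  then obtain v where "B \<subseteq> {u, v}" ..
  then show "card B \<le> 2"
    using card_mono[of "{u, v}" B] card_insert_le_m1[of 2 "{v}" u] by (auto simp: card_insert_if split: if_splits)
qed

text \<open>In a product of partial Brauer diagrams, the walk leaving an outer vertex and using blocks of
  the two factors alternately is deterministic, exhausts a connected component, and stops at the
  next outer vertex. In a state \<open>(v, c)\<close> the flag \<open>c\<close> says that the next step uses the upper
  factor.\<close>

definition stacked_link :: "diagram \<Rightarrow> diagram \<Rightarrow> bool \<Rightarrow> vertex \<Rightarrow> vertex \<Rightarrow> bool" where
  "stacked_link \<alpha> \<beta> c u v \<longleftrightarrow>
     (if c then \<exists>w z. linked \<alpha> w z \<and> u = lo_to_mid w \<and> v = lo_to_mid z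
      else \<exists>w z. linked \<beta> w z \<and> u = up_to_mid w \<and> v = up_to_mid z)"

definition walk_step :: "diagram \<Rightarrow> diagram \<Rightarrow> ((vertex \<times> bool) \<times> (vertex \<times> bool)) set" where
  "walk_step \<alpha> \<beta> = {((u, c), (v, d)). d \<noteq> c \<and> u \<noteq> v \<and> stacked_link \<alpha> \<beta> c u v}"

lemma lo_to_mid_inject: "u \<in> verts n \<Longrightarrow> v \<in> verts n \<Longrightarrow> lo_to_mid u = lo_to_mid v \<Longrightarrow> u = v"
  by (auto elim!: vertsE)

lemma up_to_mid_inject: "u \<in> verts n \<Longrightarrow> v \<in> verts n \<Longrightarrow> up_to_mid u = up_to_mid v \<Longrightarrow> u = v"
  by (auto elim!: vertsE)

lemma stacked_link_sym: "stacked_link \<alpha> \<beta> c u v \<Longrightarrow> stacked_link \<alpha> \<beta> c v u"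
  unfolding stacked_link_def by (auto split: if_splits dest: linked_symD)

text \<open>An outer vertex occurs in only one of the two factors. This fixes the flag with which a
  walk starts and prevents it from going on after its arrival at another outer vertex.\<close>

lemma stacked_link_outer:
  assumes "\<alpha> \<in> partitions n" "\<beta> \<in> partitions n" "u \<in> verts n" "stacked_link \<alpha> \<beta> c u v"
  shows "c \<longleftrightarrow> u \<in> upper n"
proof (cases c)
  case True
  then obtain w where "w \<in> verts n" "u = lo_to_mid w"
    using assms(4) linked_verts[OF assms(1)] by (auto simp: stacked_link_def)
  with True assms(3) show ?thesis
    by (cases w) (auto simp: upper_def)
next
  case False
  then obtain w where "w \<in> verts n" "u = up_to_mid w"
    using assms(4) linked_verts[OF assms(2)] by (auto simp: stacked_link_def)
  with False assms(3) show ?thesis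
    by (cases w) (auto simp: upper_def)
qed

text \<open>Each renaming is injective on the vertices of its factor, so even a middle vertex comes
  from just one vertex of the factor chosen by the flag.\<close>

lemma stacked_link_unique:
  assumes \<alpha>: "\<alpha> \<in> partitions n" "\<forall>B\<in>\<alpha>. card B \<le> 2"
    and \<beta>: "\<beta> \<in> partitions n" "\<forall>B\<in>\<beta>. card B \<le> 2"
    and uv: "stacked_link \<alpha> \<beta> c u v" "u \<noteq> v" and uw: "stacked_link \<alpha> \<beta> c u w" "u \<noteq> w"
  shows "v = w"
proof (cases c)
  case True
  then obtain a b a' d where l: "linked \<alpha> a b" "linked \<alpha> a' d" and 
    e: "u = lo_to_mid a" "u = lo_to_mid a'" "v = lo_to_mid b" "w = lo_to_mid d"
    using uv(1) uw(1) by (auto simp: stacked_link_def)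
  have "a = a'"
    using lo_to_mid_inject[of a n a'] linked_verts[OF \<alpha>(1)] l e by simp
  then have "b = d"
    using small_blocks_iff[OF \<alpha>(1)] \<alpha>(2) l e uv(2) uw(2) by metis
  then show ?thesis
    by (simp add: e)
next
  case False
  then obtain a b a' d where l: "linked \<beta> a b" "linked \<beta> a' d" and 
    e: "u = up_to_mid a" "u = up_to_mid a'" "v = up_to_mid b" "w = up_to_mid d"
    using uv(1) uw(1) by (auto simp: stacked_link_def)
  have "a = a'"
    using up_to_mid_inject[of a n a'] linked_verts[OF \<beta>(1)] l e by simp
  then have "b = d"
    using small_blocks_iff[OF \<beta>(1)] \<beta>(2) l e uv(2) uw(2) by metis
  then show ?thesis
    by (simp add: e)
qed

lemma small_blocks_mult:
  assumes \<alpha>: "\<alpha> \<in> partitions n" "\<forall>B\<in>\<alpha>. card B \<le> 2"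
    and \<beta>: "\<beta> \<in> partitions n" "\<forall>B\<in>\<beta>. card B \<le> 2"
  shows "\<forall>B\<in>diagram_mult n \<alpha> \<beta>. card B \<le> 2"
  unfolding small_blocks_iff[OF diagram_mult_partitions[OF \<alpha>(1) \<beta>(1)]]
proof (intro allI impI)
  fix u v w
  assume l: "linked (diagram_mult n \<alpha> \<beta>) u v" "linked (diagram_mult n \<alpha> \<beta>) u w" 
    and ne: "u \<noteq> v" "u \<noteq> w"
  let ?R = "walk_step \<alpha> \<beta>"
  note unique = stacked_link_unique[OF \<alpha> \<beta>]
  have verts: "u \<in> verts n" "v \<in> verts n" "w \<in> verts n"
    and uv: "(u, v) \<in> stacked_equiv \<alpha> \<beta>" and uw: "(u, w) \<in> stacked_equiv \<alpha> \<beta>"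
    using l by (simp_all add: linked_diagram_mult[OF \<alpha>(1) \<beta>(1)])
  let ?s = "(u, u \<in> upper n)"
  \<comment> \<open>The vertices on the walk are closed under all links. A link with the current
    flag is the next step. A link with the opposite flag leads back to the predecessor, by
    uniqueness; at the start of the walk no such link exists, since \<open>u\<close> is
    outer.\<close>
  have step: "\<exists>c. (?s, (z, c)) \<in> ?R\<^sup>*"
    if yz: "stacked_link \<alpha> \<beta> d y z" and y: "\<exists>c. (?s, (y, c)) \<in> ?R\<^sup>*" for d y z
  proof (cases "y = z")
    case False
    obtain c where c: "(?s, (y, c)) \<in> ?R\<^sup>*"
      using y by blast
    show ?thesis
    proof (cases "c = d")
      case True
      then have "((y, c), (z, \<not> c)) \<in> ?R"
        using yz False by (simp add: walk_step_def)
      with c show ?thesis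
        by (blast intro: rtrancl_into_rtrancl)
    next
      case cd: False
      show ?thesis
        using c
      proof (cases rule: rtranclE)
        case base
        then show ?thesis
          using stacked_link_outer[OF \<alpha>(1) \<beta>(1) verts(1)] yz cd by auto
      next
        case (step x)
        obtain p b where x: "x = (p, b)"
          by (cases x)
        have "stacked_link \<alpha> \<beta> d p y" "p \<noteq> y" and b: "b = d"
          using step(2) cd by (auto simp: x walk_step_def)
        then have "p = z"
          using unique[OF stacked_link_sym _ yz False] by blast
        then show ?thesis
          using step(1) by (auto simp: x)
      qed
    qed
  qed (use y in blast)
  have reach: "\<exists>c. (?s, (z, c)) \<in> ?R\<^sup>*" if "(u, z) \<in> stacked_equiv \<alpha> \<beta>" for z
    using that
  proof (induction rule: stacked_equiv_induct)
    case (upper a b)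
    then have "stacked_link \<alpha> \<beta> True (lo_to_mid a) (lo_to_mid b)"
      by (auto simp: stacked_link_def)
    then show ?case
      using upper(2) by (rule step)
  next
    case (lower a b)
    then have "stacked_link \<alpha> \<beta> False (up_to_mid a) (up_to_mid b)"
      by (auto simp: stacked_link_def)
    then show ?case
      using lower(2) by (rule step)
  qed blast
  \<comment> \<open>The walk arrived at \<open>z\<close> through the factor opposite to the flag
    \<open>c\<close>, so continuing would place the outer vertex \<open>z\<close> in both
    factors.\<close>
  have stop: "t \<notin> ?R `` {(z, c)}"
    if z: "(?s, (z, c)) \<in> ?R\<^sup>*" "z \<noteq> u" "z \<in> verts n" for z c t
  proof
    assume "t \<in> ?R `` {(z, c)}"
    then obtain t' where "stacked_link \<alpha> \<beta> c z t'"
      by (auto simp: walk_step_def)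
    then have cz: "c \<longleftrightarrow> z \<in> upper n"
      using stacked_link_outer[OF \<alpha>(1) \<beta>(1) z(3)] by blast
    obtain y where "(y, (z, c)) \<in> ?R"
      using z(1,2) by (auto elim: rtranclE)
    then obtain p where "stacked_link \<alpha> \<beta> (\<not> c) p z"
      by (cases y) (auto simp: walk_step_def)
    then show False
      using stacked_link_outer[OF \<alpha>(1) \<beta>(1) z(3) stacked_link_sym] cz by blast
  qed
  \<comment> \<open>Of two states reached by a deterministic walk, one is reached from the other.
    Both are terminal, so they coincide.\<close>
  have "single_valued ?R"
    by (rule single_valuedI) (auto simp: walk_step_def dest: unique)
  moreover obtain c d where c: "(?s, (v, c)) \<in> ?R\<^sup>*" and d: "(?s, (w, d)) \<in> ?R\<^sup>*"
    using reach[OF uv] reach[OF uw] by blast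
  ultimately have "((v, c), (w, d)) \<in> ?R\<^sup>* \<or> ((w, d), (v, c)) \<in> ?R\<^sup>*"
    by (rule single_valued_confluent)
  then show "v = w"
    using stop[OF c ne(1)[symmetric] verts(2)] stop[OF d ne(2)[symmetric] verts(3)]
    by (auto elim: converse_rtranclE)
qed

lemma small_blocks_star: "\<forall>B\<in>\<alpha>. card B \<le> 2 \<Longrightarrow> \<forall>B\<in>star \<alpha>. card B \<le> 2"
  unfolding star_def using inj_flip card_image[OF inj_on_subset[OF inj_flip]] by auto

section \<open>Closure of the planar partition monoid\<close>

text \<open>The set \<open>S\<close> of points still present is separate from the relation, because
  deleted points go on carrying links between the remaining ones.\<close>

definition noncrossing :: "nat set \<Rightarrow> (nat \<times> nat) set \<Rightarrow> bool" where
  "noncrossing S R \<longleftrightarrow> (\<forall>a\<in>S. \<forall>b\<in>S. \<forall>c\<in>S. \<forall>d\<in>S.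
     a < b \<longrightarrow> b < c \<longrightarrow> c < d \<longrightarrow> (a, c) \<in> R \<longrightarrow> (b, d) \<in> R \<longrightarrow> (a, b) \<in> R)"

text \<open>For a symmetric and transitive \<open>R\<close> with \<open>p\<close> and
  \<open>q\<close> in its field, this is the closure under the new link from \<open>p\<close> to
  \<open>q\<close>: a path using that link several times can be shortened to use it at most
  once.\<close>

definition merge :: "nat \<Rightarrow> nat \<Rightarrow> (nat \<times> nat) set \<Rightarrow> (nat \<times> nat) set" where
  "merge p q R = R \<union> {(x, y). (x, p) \<in> R \<and> (q, y) \<in> R} \<union> {(x, y). (x, q) \<in> R \<and> (p, y) \<in> R}"

lemma sym_merge: "sym R \<Longrightarrow> sym (merge p q R)"
  unfolding sym_def merge_def by blast

lemma trans_merge: "sym R \<Longrightarrow> trans R \<Longrightarrow> trans (merge p q R)"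
  unfolding sym_def trans_def merge_def by blast

text \<open>A block not containing the chord from \<open>b\<close> to \<open>d\<close> stays on one
  side of it: \<open>c < b\<close> would give the crossing \<open>c < b < a < d\<close>, and
  \<open>d < c\<close> the crossing \<open>b < a < d < c\<close>.\<close>

lemma noncrossing_side:
  assumes R: "sym R" "trans R" "noncrossing S R"
    and S: "a \<in> S" "b \<in> S" "c \<in> S" "d \<in> S"
    and ac: "(a, c) \<in> R" and bd: "(b, d) \<in> R" and ab: "(a, b) \<notin> R"
    and a: "b < a" "a < d"
  shows "b < c \<and> c < d"
proof -
  have sym: "\<And>x y. (x, y) \<in> R \<Longrightarrow> (y, x) \<in> R" and trans: "\<And>x y z. (x, y) \<in> R \<Longrightarrow> (y, z) \<in> R \<Longrightarrow> (x, z) \<in> R"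
    using R by (auto dest: symD transD)
  have "c \<noteq> b" "c \<noteq> d" 
    using ac bd ab sym trans by blast+
  moreover have "\<not> c < b"
    using R(3) S a ac bd ab sym trans unfolding noncrossing_def by meson
  moreover have "\<not> d < c"
    using R(3) S a ac bd ab sym trans unfolding noncrossing_def by meson
  ultimately show ?thesis
    by auto
qed

text \<open>Two adjacent points lie on the same side of every chord \<open>b d\<close> of a third block.\<close>

lemma noncrossing_merge:
  assumes R: "sym R" "trans R" "noncrossing S R"
    and pq: "p \<in> S" "q \<in> S" "p < q" "(p, p) \<in> R" "(q, q) \<in> R"
    and adj: "\<And>s. s \<in> S \<Longrightarrow> \<not> (p < s \<and> s < q)"
  shows "noncrossing (S - {p, q}) (merge p q R)"
proof -
  have sym: "\<And>x y. (x, y) \<in> R \<Longrightarrow> (y, x) \<in> R" and trans: "\<And>x y z. (x, y) \<in> R \<Longrightarrow> (y, z) \<in> R \<Longrightarrow> (x, z) \<in> R"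
    using R by (auto dest: symD transD)
  have side: "b < c \<and> c < d \<longleftrightarrow> b < a \<and> a < d"
    if S: "a \<in> S - {p, q}" "b \<in> S - {p, q}" "c \<in> S - {p, q}" "d \<in> S - {p, q}"
      and ac: "(a, c) \<in> merge p q R" and bd: "(b, d) \<in> R" and ab: "(a, b) \<notin> merge p q R" for a b c d
  proof -
    have iff: "b < y \<and> y < d \<longleftrightarrow> b < x \<and> x < d" 
      if "x \<in> S" "y \<in> S" "(x, y) \<in> R" "(x, b) \<notin> R" for x y
    proof -
      have "(y, b) \<notin> R"
        using that sym trans by blast
      then show ?thesis
        using noncrossing_side[OF R, of x b y d] noncrossing_side[OF R, of y b x d] that S bd sym by blast
    qed
    have pq_side: "b < p \<and> p < d \<longleftrightarrow> b < q \<and> q < d"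
    proof -
      have "\<not> (p < b \<and> b < q)" "\<not> (p < d \<and> d < q)" "b \<noteq> p" "b \<noteq> q" "d \<noteq> p" "d \<noteq> q"
        using adj S by auto
      then show ?thesis
        using pq(3) by linarith
    qed
    have "(a, b) \<notin> R"
      using ab unfolding merge_def by blast
    consider "(a, c) \<in> R" | "(a, p) \<in> R" "(q, c) \<in> R" "(q, b) \<notin> R"
      | "(a, q) \<in> R" "(p, c) \<in> R" "(p, b) \<notin> R"
      using ac ab unfolding merge_def by blast
    then show ?thesis
    proof cases
      case 1
      then show ?thesis
        using iff[of a c] S \<open>(a, b) \<notin> R\<close> by simp
    next
      case 2
      then show ?thesis
        using iff[of a p] iff[of q c] S pq \<open>(a, b) \<notin> R\<close> pq_side by simp
    next
      case 3
      then show ?thesis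
        using iff[of a q] iff[of p c] S pq \<open>(a, b) \<notin> R\<close> pq_side by simp
    qed
  qed
  show ?thesis
    unfolding noncrossing_def
  proof (intro ballI impI, rule ccontr)
    fix a b c d
    assume S: "a \<in> S - {p, q}" "b \<in> S - {p, q}" "c \<in> S - {p, q}" "d \<in> S - {p, q}"
      and less: "a < b" "b < c" "c < d"
      and ac: "(a, c) \<in> merge p q R" and bd: "(b, d) \<in> merge p q R" and ab: "(a, b) \<notin> merge p q R"
    have ba: "(b, a) \<notin> merge p q R"
      using ab sym_merge[OF R(1)] by (auto dest: symD)
    \<comment> \<open>If one chord is old, the ends of the other lie on different sides of it. If
      both use the new link, \<open>a\<close> and \<open>b\<close> already lie in the merged
      class.\<close>
    consider "(b, d) \<in> R" | "(a, c) \<in> R" | "(a, c) \<notin> R" "(b, d) \<notin> R"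
      by blast
    then show False
    proof cases
      case 1
      then show ?thesis
        using side[OF S ac _ ab] less by auto
    next
      case 2
      then show ?thesis
        using side[OF S(2,1,4,3) bd _ ba] less by auto
    next
      case 3
      then have "(a, p) \<in> R \<or> (a, q) \<in> R" "(b, p) \<in> R \<or> (b, q) \<in> R"
        using ac bd unfolding merge_def by blast+
      then show ?thesis
        using ab sym trans unfolding merge_def by blast
    qed
  qed
qed

section \<open>Planarity of products by gluing on a line\<close>

lemma planar_iff:
  assumes \<alpha>: "\<alpha> \<in> partitions n"
  shows "planar n \<alpha> \<longleftrightarrow> (\<forall>a b c d. linked \<alpha> a c \<longrightarrow> linked \<alpha> b d \<longrightarrow>
    pos n a < pos n b \<longrightarrow> pos n b < pos n c \<longrightarrow> pos n c < pos n d \<longrightarrow> linked \<alpha> a b)"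
    (is "_ \<longleftrightarrow> ?R")
proof
  assume p: "planar n \<alpha>"
  show ?R
  proof (intro allI impI)
    fix a b c d
    assume "linked \<alpha> a c" "linked \<alpha> b d" and l: "pos n a < pos n b" "pos n b < pos n c" "pos n c < pos n d"
    then obtain A B where "A \<in> \<alpha>" "B \<in> \<alpha>" "a \<in> A" "c \<in> A" "b \<in> B" "d \<in> B"
      by (auto simp: linked_def)
    moreover from this have "A = B"
      using p l unfolding planar_def by metis
    ultimately show "linked \<alpha> a b"
      by (auto simp: linked_def)
  qed
next
  assume r: ?R
  show "planar n \<alpha>"
    unfolding planar_def
  proof (clarify)
    fix A B a b c d
    assume AB: "A \<in> \<alpha>" "B \<in> \<alpha>" "A \<noteq> B" "a \<in> A" "c \<in> A" "b \<in> B" "d \<in> B"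
      "pos n a < pos n b" "pos n b < pos n c" "pos n c < pos n d"
    have "linked \<alpha> a c" "linked \<alpha> b d"
      using AB unfolding linked_def by blast+
    then have "linked \<alpha> a b"
      using r AB(8-10) by blast
    then have "b \<in> A"
      using linked_blockD[OF \<alpha> _ AB(1,4)] by blast
    then show False
      using blocks_eq[OF \<alpha> AB(1,2)] AB(3,6) by blast
  qed
qed

lemma pos_range: "u \<in> verts n \<Longrightarrow> pos n u \<in> {1..2 * n}"
  by (auto elim!: vertsE)

lemma pos_inject: "u \<in> verts n \<Longrightarrow> v \<in> verts n \<Longrightarrow> pos n u = pos n v \<Longrightarrow> u = v"
  by (auto elim!: vertsE)

text \<open>The two factors occupy the positions \<open>1..2n\<close> and \<open>2n+1..4n\<close>, so that gluing the middle
  rows glues \<open>2n\<close> to \<open>2n+1\<close>, then \<open>2n-1\<close> to \<open>2n+2\<close>, and so on; each pair is adjacent once its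
  predecessors are deleted.\<close>

primrec glued :: "nat \<Rightarrow> diagram \<Rightarrow> diagram \<Rightarrow> nat \<Rightarrow> (nat \<times> nat) set" where
  "glued n \<alpha> \<beta> 0 = {(pos n u, pos n v) | u v. linked \<alpha> u v} \<union>
     {(2 * n + pos n u, 2 * n + pos n v) | u v. linked \<beta> u v}"
| "glued n \<alpha> \<beta> (Suc k) = merge (2 * n - k) (2 * n + 1 + k) (glued n \<alpha> \<beta> k)"

text \<open>Reads the line of \<open>4n\<close> points as four rows, the lower row of each factor
  being traversed backwards. Thus \<open>2 * n - k\<close> and \<open>2 * n + 1 + k\<close> both
  carry \<open>Mid (k + 1)\<close> for \<open>k < n\<close>, and the pairs to be glued are
  nested.\<close>

definition glued_vertex :: "nat \<Rightarrow> nat \<Rightarrow> vertex" where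
  "glued_vertex n i = (if i \<le> n then Up i else if i \<le> 2 * n then Mid (2 * n + 1 - i)
     else if i \<le> 3 * n then Mid (i - 2 * n) else Lo (4 * n + 1 - i))"

lemma glued_vertex_pos:
  "u \<in> verts n \<Longrightarrow> glued_vertex n (pos n u) = lo_to_mid u"
  "u \<in> verts n \<Longrightarrow> glued_vertex n (2 * n + pos n u) = up_to_mid u"
  by (auto simp: glued_vertex_def elim!: vertsE)

context
  fixes n \<alpha> \<beta>
  assumes \<alpha>: "\<alpha> \<in> partitions n" and \<beta>: "\<beta> \<in> partitions n"
begin

lemma glued_0E:
  assumes "(x, y) \<in> glued n \<alpha> \<beta> 0"
  obtains u v where "linked \<alpha> u v" "x = pos n u" "y = pos n v" "x \<le> 2 * n" "y \<le> 2 * n"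
  | u v where "linked \<beta> u v" "x = 2 * n + pos n u" "y = 2 * n + pos n v" "x > 2 * n" "y > 2 * n"
proof -
  consider u v where "linked \<alpha> u v" "x = pos n u" "y = pos n v"
    | u v where "linked \<beta> u v" "x = 2 * n + pos n u" "y = 2 * n + pos n v"
    using assms by auto
  then show thesis
  proof cases
    case 1
    then show thesis
      using that(1) pos_range[of u n] pos_range[of v n] linked_verts[OF \<alpha> 1(1)] by auto
  next
    case 2
    then show thesis
      using that(2) pos_range[of u n] pos_range[of v n] linked_verts[OF \<beta> 2(1)] by auto
  qed
qed

lemma sym_glued: "sym (glued n \<alpha> \<beta> k)"
proof (induction k)
  case 0
  show ?case
    by (rule symI) (simp, blast dest: linked_symD)
next
  case (Suc k)
  then show ?case
    by (simp add: sym_merge)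
qed

lemma trans_glued: "trans (glued n \<alpha> \<beta> k)"
proof (induction k)
  case 0
  show ?case
  proof (rule transI)
    fix x y z assume xy: "(x, y) \<in> glued n \<alpha> \<beta> 0" and yz: "(y, z) \<in> glued n \<alpha> \<beta> 0"
    from xy show "(x, z) \<in> glued n \<alpha> \<beta> 0"
    proof (cases rule: glued_0E)
      case (1 u v)
      note xy = this
      from yz show ?thesis
      proof (cases rule: glued_0E)
        case (1 v' w)
        then have "linked \<alpha> u w"
          using xy pos_inject[of v n v'] linked_verts[OF \<alpha>] linked_trans[OF \<alpha>] by metis
        then show ?thesis
          using xy 1 by auto
      qed (use xy in linarith)
    next
      case (2 u v)
      note xy = this
      from yz show ?thesis
      proof (cases rule: glued_0E)
        case (2 v' w)
        then have "linked \<beta> u w"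
          using xy pos_inject[of v n v'] linked_verts[OF \<beta>] linked_trans[OF \<beta>]
          by (metis add_left_cancel)
        then show ?thesis
          using xy 2 by auto
      qed (use xy in linarith)
    qed
  qed
next
  case (Suc k)
  then show ?case
    by (simp add: trans_merge sym_glued)
qed

lemma glued_mono: "k \<le> l \<Longrightarrow> glued n \<alpha> \<beta> k \<subseteq> glued n \<alpha> \<beta> l"
  by (rule lift_Suc_mono_le[of "glued n \<alpha> \<beta>"]) (auto simp: merge_def)

lemma glued_linked:
  "linked \<alpha> u v \<Longrightarrow> (pos n u, pos n v) \<in> glued n \<alpha> \<beta> k"
  "linked \<beta> u v \<Longrightarrow> (2 * n + pos n u, 2 * n + pos n v) \<in> glued n \<alpha> \<beta> k"
  by (rule subsetD[OF glued_mono[of 0 k]]; simp; blast)+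

text \<open>\<open>merge\<close> joins \<open>p\<close> to \<open>q\<close> by way of the reflexive
  pairs at both points, so these must be present.\<close>

lemma glued_refl:
  assumes "i \<in> {1..4 * n}"
  shows "(i, i) \<in> glued n \<alpha> \<beta> k"
proof -
  have ex: "\<exists>u\<in>verts n. pos n u = j" if "j \<in> {1..2 * n}" for j
  proof (cases "j \<le> n")
    case True
    then show ?thesis
      using that by (intro bexI[of _ "Up j"]) auto
  next
    case False
    then show ?thesis
      using that by (intro bexI[of _ "Lo (2 * n + 1 - j)"]) auto
  qed
  have "(i, i) \<in> glued n \<alpha> \<beta> 0"
  proof (cases "i \<le> 2 * n")
    case True
    then show ?thesis
      using ex[of i] assms linked_refl[OF \<alpha>] by auto
  next
    case False
    then obtain u where "u \<in> verts n" "pos n u = i - 2 * n"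
      using ex[of "i - 2 * n"] assms by fastforce
    then have "linked \<beta> u u" "i = 2 * n + pos n u"
      using False linked_refl[OF \<beta>] by auto
    then show ?thesis
      by auto
  qed
  then show ?thesis
    using glued_mono[of 0 k] by blast
qed

lemma noncrossing_glued:
  assumes "planar n \<alpha>" "planar n \<beta>" "k \<le> n"
  shows "noncrossing ({1..4 * n} - {2 * n - k<..2 * n + k}) (glued n \<alpha> \<beta> k)"
  using assms(3)
proof (induction k)
  case 0
  have "(a, b) \<in> glued n \<alpha> \<beta> 0"
    if less: "a < b" "b < c" "c < d" and ac: "(a, c) \<in> glued n \<alpha> \<beta> 0" and bd: "(b, d) \<in> glued n \<alpha> \<beta> 0"
    for a b c d
  proof -
    \<comment> \<open>All positions of \<alpha> precede those of \<beta>, so interleaved chords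
      belong to the same factor.\<close>
    consider u v w z where "linked \<alpha> u w" "linked \<alpha> v z" "a = pos n u" "c = pos n w" "b = pos n v" "d = pos n z"
      | u v w z where "linked \<beta> u w" "linked \<beta> v z" "a = 2 * n + pos n u" "c = 2 * n + pos n w"
        "b = 2 * n + pos n v" "d = 2 * n + pos n z"
      using ac bd
    proof (elim glued_0E)
    qed (use less that in auto)
    then show ?thesis
    proof cases
      case 1
      then have "linked \<alpha> u v"
        using less assms(1)[unfolded planar_iff[OF \<alpha>], rule_format, of u w v z] by simp
      then show ?thesis
        using 1 by auto
    next
      case 2
      then have "linked \<beta> u v"
        using less assms(2)[unfolded planar_iff[OF \<beta>], rule_format, of u w v z] by simp
      then show ?thesis
        using 2 by auto
    qed
  qed
  then show ?case
    unfolding noncrossing_def by blast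
next
  case (Suc k)
  \<comment> \<open>The deleted interval is open on the left, so \<open>?p\<close> and
    \<open>?q\<close> are the points just outside it on either side: both survive and are neighbours
    in \<open>?S\<close>.\<close>
  let ?S = "{1..4 * n} - {2 * n - k<..2 * n + k}" and ?p = "2 * n - k" and ?q = "2 * n + 1 + k"
  have "noncrossing (?S - {?p, ?q}) (glued n \<alpha> \<beta> (Suc k))"
    unfolding glued.simps using Suc
    by (intro noncrossing_merge sym_glued trans_glued glued_refl) auto
  moreover have "?S - {?p, ?q} = {1..4 * n} - {2 * n - Suc k<..2 * n + Suc k}"
    using Suc.prems by auto
  ultimately show ?case
    by simp
qed

lemma glued_imp_stacked_equiv:
  assumes "k \<le> n" "(i, j) \<in> glued n \<alpha> \<beta> k"
  shows "(glued_vertex n i, glued_vertex n j) \<in> stacked_equiv \<alpha> \<beta>"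
  using assms
proof (induction k arbitrary: i j)
  case 0
  then consider u v where "linked \<alpha> u v" "i = pos n u" "j = pos n v"
    | u v where "linked \<beta> u v" "i = 2 * n + pos n u" "j = 2 * n + pos n v"
    by auto
  then show ?case
  proof cases
    case 1
    then show ?thesis
      using stacked_equiv_upper[OF 1(1)] linked_verts[OF \<alpha> 1(1)] by (simp add: glued_vertex_pos)
  next
    case 2
    then show ?thesis
      using stacked_equiv_lower[OF 2(1)] linked_verts[OF \<beta> 2(1)] by (simp add: glued_vertex_pos)
  qed
next
  case (Suc k)
  have "glued_vertex n (2 * n - k) = glued_vertex n (2 * n + 1 + k)"
    using Suc.prems(1) by (auto simp: glued_vertex_def)
  moreover have IH: "(glued_vertex n i, glued_vertex n j) \<in> stacked_equiv \<alpha> \<beta>"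
    if "(i, j) \<in> glued n \<alpha> \<beta> k" for i j
    using Suc.IH[OF _ that] Suc.prems(1) by simp
  ultimately show ?case
    using Suc.prems(2) IH[of i j] IH[of i "2 * n - k"] IH[of "2 * n + 1 + k" j]
      IH[of i "2 * n + 1 + k"] IH[of "2 * n - k" j] stacked_equiv_trans
    unfolding glued.simps merge_def by fastforce
qed

text \<open>A middle vertex has two positions. The induction therefore concerns every position of
  the vertex reached, and \<open>same\<close> passes from one position to the other.\<close>

lemma stacked_equiv_imp_glued:
  assumes "(glued_vertex n i, w) \<in> stacked_equiv \<alpha> \<beta>"
    and i: "i \<in> {1..4 * n}" and j: "j \<in> {1..4 * n}" and "glued_vertex n j = w"
  shows "(i, j) \<in> glued n \<alpha> \<beta> n"
proof -
  have trans: "(x, y) \<in> glued n \<alpha> \<beta> n \<Longrightarrow> (y, z) \<in> glued n \<alpha> \<beta> n \<Longrightarrow> (x, z) \<in> glued n \<alpha> \<beta> n" for x y z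
    using trans_glued by (blast dest: transD)
  have same: "(i, j) \<in> glued n \<alpha> \<beta> n"
    if ij: "i \<in> {1..4 * n}" "j \<in> {1..4 * n}" and eq: "glued_vertex n i = glued_vertex n j" for i j
  proof -
    have glue: "(2 * n - k, 2 * n + 1 + k) \<in> glued n \<alpha> \<beta> n" if "k < n" for k
    proof -
      have "(2 * n - k, 2 * n + 1 + k) \<in> glued n \<alpha> \<beta> (Suc k)"
      proof -
        have "2 * n - k \<in> {1..4 * n}" "2 * n + 1 + k \<in> {1..4 * n}"
          unfolding atLeastAtMost_iff using that by linarith+
        then show ?thesis
          using glued_refl[of _ k] by (simp add: merge_def)
      qed
      then show ?thesis
        using glued_mono[of "Suc k" n] that by auto
    qed
    consider "i = j" | k where "k < n" "i = 2 * n - k" "j = 2 * n + 1 + k"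
      | k where "k < n" "j = 2 * n - k" "i = 2 * n + 1 + k"
    proof -
      have "i = j \<or> (\<exists>k<n. i = 2 * n - k \<and> j = 2 * n + 1 + k) \<or> (\<exists>k<n. j = 2 * n - k \<and> i = 2 * n + 1 + k)"
        using ij eq unfolding glued_vertex_def
        by (auto split: if_splits intro: exI[of _ "2 * n - i"] exI[of _ "2 * n - j"])
      then show thesis
        using that by blast
    qed
    then show ?thesis
      using glue glued_refl[OF ij(1)] symD[OF sym_glued] by cases blast+
  qed
  have "\<forall>j\<in>{1..4 * n}. glued_vertex n j = w \<longrightarrow> (i, j) \<in> glued n \<alpha> \<beta> n"
    using assms(1)
  proof (induction rule: stacked_equiv_induct)
    case refl
    then show ?case
      using same i by simp
  next
    case (upper u v)
    have v: "u \<in> verts n" "v \<in> verts n"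
      using linked_verts[OF \<alpha> upper(1)] by auto
    have "(i, pos n u) \<in> glued n \<alpha> \<beta> n"
      using upper(2) pos_range[OF v(1)] v by (auto simp: glued_vertex_pos)
    moreover have "(pos n u, pos n v) \<in> glued n \<alpha> \<beta> n"
      by (rule glued_linked(1)[OF upper(1)])
    ultimately have "(i, pos n v) \<in> glued n \<alpha> \<beta> n"
      by (rule trans)
    moreover have "(pos n v, j) \<in> glued n \<alpha> \<beta> n" 
      if "j \<in> {1..4 * n}" "glued_vertex n j = lo_to_mid v" for j
      using that pos_range[OF v(2)] v by (intro same) (auto simp: glued_vertex_pos)
    ultimately show ?case
      using trans by blast
  next
    case (lower u v)
    have v: "u \<in> verts n" "v \<in> verts n"
      using linked_verts[OF \<beta> lower(1)] by auto
    have "(i, 2 * n + pos n u) \<in> glued n \<alpha> \<beta> n"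
      using lower(2) pos_range[OF v(1)] v by (auto simp: glued_vertex_pos)
    moreover have "(2 * n + pos n u, 2 * n + pos n v) \<in> glued n \<alpha> \<beta> n"
      by (rule glued_linked(2)[OF lower(1)])
    ultimately have "(i, 2 * n + pos n v) \<in> glued n \<alpha> \<beta> n"
      by (rule trans)
    moreover have "(2 * n + pos n v, j) \<in> glued n \<alpha> \<beta> n" 
      if "j \<in> {1..4 * n}" "glued_vertex n j = up_to_mid v" for j
      using that pos_range[OF v(2)] v by (intro same) (auto simp: glued_vertex_pos)
    ultimately show ?case
      using trans by blast
  qed
  then show ?thesis
    using j assms(4) by blast
qed

lemma planar_mult:
  assumes "planar n \<alpha>" "planar n \<beta>"
  shows "planar n (diagram_mult n \<alpha> \<beta>)"
proof -
  \<comment> \<open>\<open>f\<close> is the position of an outer vertex on the long line. Its values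
    \<open>1..n\<close> and \<open>3n+1..4n\<close> avoid all points deleted by the \<open>n\<close>
    gluings, and it preserves the order of \<open>pos\<close>.\<close>
  define f where "f u = (if u \<in> upper n then pos n u else 2 * n + pos n u)" for u
  have f: "f u \<in> {1..4 * n} - {2 * n - n<..2 * n + n}" "glued_vertex n (f u) = u" if "u \<in> verts n" for u
    using that by (auto simp: f_def upper_def glued_vertex_def elim!: vertsE)
  have mono: "f u < f v" if "u \<in> verts n" "v \<in> verts n" "pos n u < pos n v" for u v
    using that by (auto simp: f_def upper_def elim!: vertsE)
  have linked: "linked (diagram_mult n \<alpha> \<beta>) u v \<longleftrightarrow> (f u, f v) \<in> glued n \<alpha> \<beta> n" 
    if "u \<in> verts n" "v \<in> verts n" for u v
    using that f[OF that(1)] f[OF that(2)] glued_imp_stacked_equiv[of n "f u" "f v"] 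
      stacked_equiv_imp_glued[of "f u" v "f v"]
    by (auto simp: linked_diagram_mult[OF \<alpha> \<beta>])
  show ?thesis
    unfolding planar_iff[OF diagram_mult_partitions[OF \<alpha> \<beta>]]
  proof (intro allI impI)
    fix a b c d
    assume l: "linked (diagram_mult n \<alpha> \<beta>) a c" "linked (diagram_mult n \<alpha> \<beta>) b d"
      and less: "pos n a < pos n b" "pos n b < pos n c" "pos n c < pos n d"
    have v: "a \<in> verts n" "b \<in> verts n" "c \<in> verts n" "d \<in> verts n"
      using l linked_verts[OF diagram_mult_partitions[OF \<alpha> \<beta>]] by blast+
    have "(f a, f b) \<in> glued n \<alpha> \<beta> n"
      using noncrossing_glued[OF assms order_refl, unfolded noncrossing_def, rule_format,
          OF f(1) f(1) f(1) f(1) mono mono mono] v less l linked by blast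
    then show "linked (diagram_mult n \<alpha> \<beta>) a b"
      using linked v by blast
  qed
qed

end

text \<open>\<open>flip\<close> reverses the order of positions, so a crossing pattern is read from
  the other end; the link obtained between \<open>d\<close> and \<open>c\<close> is then carried
  over to \<open>a\<close> and \<open>b\<close>.\<close>

lemma planar_star:
  assumes \<alpha>: "\<alpha> \<in> partitions n" and "planar n \<alpha>"
  shows "planar n (star \<alpha>)"
  unfolding planar_iff[OF star_partitions[OF \<alpha>]] linked_star
proof (intro allI impI)
  fix a b c d
  assume l: "linked \<alpha> (flip a) (flip c)" "linked \<alpha> (flip b) (flip d)"
    and less: "pos n a < pos n b" "pos n b < pos n c" "pos n c < pos n d"
  have v: "a \<in> verts n" "b \<in> verts n" "c \<in> verts n" "d \<in> verts n"
    using linked_verts[OF \<alpha> l(1)] linked_verts[OF \<alpha> l(2)] by auto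
  have "pos n (flip u) = 2 * n + 1 - pos n u" if "u \<in> verts n" for u
    using that by (auto elim!: vertsE)
  then have "pos n (flip v) < pos n (flip u)" 
    if "u \<in> verts n" "v \<in> verts n" "pos n u < pos n v" for u v
    using that pos_range[of u n] pos_range[of v n] by auto
  then have "linked \<alpha> (flip d) (flip c)"
    using assms(2)[unfolded planar_iff[OF \<alpha>], rule_format, of "flip d" "flip b" "flip c" "flip a"]
      l v less linked_symD by blast
  then show "linked \<alpha> (flip a) (flip b)"
    using l linked_symD linked_trans[OF \<alpha>] by blast
qed

section \<open>Partial identities\<close>

definition pad :: "nat \<Rightarrow> diagram \<Rightarrow> diagram" where
  "pad n P = P \<union> (\<lambda>v. {v}) ` (verts n - \<Union>P)"

definition strands :: "nat \<Rightarrow> (nat \<times> nat) set \<Rightarrow> diagram" where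
  "strands n T = pad n ((\<lambda>(x, y). {Up x, Lo y}) ` T)"

text \<open>Links the two points of the generator of the action, so that multiplication by it
  enlarges the kernel and yields the extra point. Its one nontrivial block is a pair of neighbours,
  which suits all four monoids.\<close>

definition cup :: "nat \<Rightarrow> diagram" where
  "cup n = pad n {{Up 1, Up 2}}"

lemma pad_partitions:
  "\<Union>P \<subseteq> verts n \<Longrightarrow> disjoint P \<Longrightarrow> {} \<notin> P \<Longrightarrow> pad n P \<in> partitions n"
  unfolding partitions_def partition_on_def pad_def disjoint_def by auto

lemma linked_pad:
  "\<Union>P \<subseteq> verts n \<Longrightarrow> linked (pad n P) u v \<longleftrightarrow> u = v \<and> u \<in> verts n \<or> (\<exists>B\<in>P. u \<in> B \<and> v \<in> B)"
  unfolding linked_def pad_def by auto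

lemma pad_small_blocks:
  "\<forall>B\<in>P. card B \<le> 2 \<Longrightarrow> \<forall>B\<in>pad n P. card B \<le> 2"
  unfolding pad_def by auto

locale partial_injection =
  fixes n :: nat and T :: "(nat \<times> nat) set"
  assumes T_subset: "T \<subseteq> {1..n} \<times> {1..n}"
    and T_inject: "(x, y) \<in> T \<Longrightarrow> (x', y') \<in> T \<Longrightarrow> x = x' \<longleftrightarrow> y = y'"
begin

lemma strands_partitions: "strands n T \<in> partitions n"
  unfolding strands_def
proof (rule pad_partitions)
  show "\<Union> ((\<lambda>(x, y). {Up x, Lo y}) ` T) \<subseteq> verts n"
    using T_subset by auto
  show "disjoint ((\<lambda>(x, y). {Up x, Lo y}) ` T)"
    using T_inject by (auto simp: disjoint_def)
qed auto

lemma linked_strands: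
  "linked (strands n T) u v \<longleftrightarrow>
    u = v \<and> u \<in> verts n \<or> (\<exists>(x, y)\<in>T. u \<in> {Up x, Lo y} \<and> v \<in> {Up x, Lo y})"
proof -
  have "\<Union> ((\<lambda>(x, y). {Up x, Lo y}) ` T) \<subseteq> verts n"
    using T_subset by auto
  then show ?thesis
    unfolding strands_def by (simp add: linked_pad case_prod_beta)
qed

lemma strands_small_blocks: "\<forall>B\<in>strands n T. card B \<le> 2"
  unfolding strands_def by (rule pad_small_blocks) (auto simp: card_insert_if)

text \<open>Every nontrivial chord joins an upper to a lower vertex, and lower positions run
  backwards. A crossing would thus give \<open>x < x'\<close> together with
  \<open>y' < y\<close>.\<close>

lemma strands_planar:
  assumes mono: "\<And>x y x' y'. (x, y) \<in> T \<Longrightarrow> (x', y') \<in> T \<Longrightarrow> x < x' \<Longrightarrow> y < y'"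
  shows "planar n (strands n T)"
  unfolding planar_iff[OF strands_partitions]
proof (intro allI impI)
  fix a b c d
  assume l: "linked (strands n T) a c" "linked (strands n T) b d"
    and less: "pos n a < pos n b" "pos n b < pos n c" "pos n c < pos n d"
  have ends: "\<exists>(x, y)\<in>T. u = Up x \<and> v = Lo y" if "linked (strands n T) u v" "pos n u < pos n v" for u v
  proof -
    have "\<exists>(x, y)\<in>T. u \<in> {Up x, Lo y} \<and> v \<in> {Up x, Lo y}"
      using that unfolding linked_strands by (elim disjE conjE) simp_all
    then obtain x y where xy: "(x, y) \<in> T" "u \<in> {Up x, Lo y}" "v \<in> {Up x, Lo y}"
      by blast
    moreover have "x \<le> n" "y \<le> n"
      using xy T_subset by auto
    ultimately have "u = Up x" "v = Lo y"
      using that(2) by auto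
    then show ?thesis
      using xy(1) by blast
  qed
  obtain x y where xy: "(x, y) \<in> T" "a = Up x" "c = Lo y"
    using ends[OF l(1)] less by auto
  obtain x' y' where xy': "(x', y') \<in> T" "b = Up x'" "d = Lo y'"
    using ends[OF l(2)] less by auto
  have "y < y'"
    using mono[OF xy(1) xy'(1)] less xy xy' by simp
  then show "linked (strands n T) a b"
    using less(3) xy xy' by simp
qed

lemma inv_rel_strands:
  "(F, G) \<in> inv_rel n (strands n T) \<longleftrightarrow>
    F \<subseteq> {1..n} \<and> G \<subseteq> {1..n} \<and> (\<forall>(x, y)\<in>T. x \<in> F \<longleftrightarrow> y \<in> G)"
  unfolding inv_rel_def linked_strands by fastforce

lemma rank_strands:
  assumes "finite T"
  shows "rank (strands n T) \<le> card T"
proof -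
  have "{B \<in> strands n T. (\<exists>x. Up x \<in> B) \<and> (\<exists>y. Lo y \<in> B)} \<subseteq> (\<lambda>(x, y). {Up x, Lo y}) ` T"
    unfolding strands_def pad_def by auto
  then show ?thesis
    unfolding rank_def using assms by (meson card_image_le card_mono finite_imageI order_trans)
qed

end

section \<open>Partial identities and what they detect of a diagram\<close>

lemma partial_injection_Id_on: "A \<subseteq> {1..n} \<Longrightarrow> partial_injection n (Id_on A)"
  by unfold_locales auto

abbreviation partial_id :: "nat \<Rightarrow> nat set \<Rightarrow> diagram" where
  "partial_id n A \<equiv> strands n (Id_on A)"

lemma inv_rel_partial_id:
  assumes "A \<subseteq> {1..n}"
  shows "(F, G) \<in> inv_rel n (partial_id n A) \<longleftrightarrow> F \<subseteq> {1..n} \<and> G \<subseteq> {1..n} \<and> F \<inter> A = G \<inter> A"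
  unfolding partial_injection.inv_rel_strands[OF partial_injection_Id_on[OF assms]] by auto

lemma partial_id_partitions: "A \<subseteq> {1..n} \<Longrightarrow> partial_id n A \<in> partitions n"
  by (rule partial_injection.strands_partitions[OF partial_injection_Id_on])

lemma diagram_one_eq: "diagram_one n = partial_id n {1..n}"
proof -
  have "(\<lambda>(x, y). {Up x, Lo y}) ` Id_on {1..n} = diagram_one n"
    unfolding diagram_one_def by force
  moreover have "verts n - \<Union> (diagram_one n) = {}"
    by (auto simp: diagram_one_def elim!: vertsE)
  ultimately show ?thesis
    unfolding strands_def pad_def by (simp only: image_empty Un_empty_right)
qed

lemma inv_rel_diagram_one: "inv_rel n (diagram_one n) = Id_on (Pow {1..n})"
proof -
  have "(F, G) \<in> inv_rel n (diagram_one n) \<longleftrightarrow> (F, G) \<in> Id_on (Pow {1..n})" for F G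
    unfolding diagram_one_eq
    by (subst inv_rel_partial_id) (simp_all add: Id_on_iff Int_absorb2 conj_commute cong: conj_cong, blast)
  then show ?thesis
    by auto
qed

lemma diagram_one_mult:
  assumes "\<alpha> \<in> partitions n"
  shows "diagram_mult n (diagram_one n) \<alpha> = \<alpha>" "diagram_mult n \<alpha> (diagram_one n) = \<alpha>"
proof -
  have one: "diagram_one n \<in> partitions n"
    by (simp add: diagram_one_eq partial_id_partitions)
  have "Id_on (Pow {1..n}) O inv_rel n \<alpha> = inv_rel n \<alpha>" "inv_rel n \<alpha> O Id_on (Pow {1..n}) = inv_rel n \<alpha>"
    by (force dest: inv_rel_subset)+
  then show "diagram_mult n (diagram_one n) \<alpha> = \<alpha>" "diagram_mult n \<alpha> (diagram_one n) = \<alpha>"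
    using assms one
    by (simp_all add: inv_rel_inject[of _ n] diagram_mult_partitions inv_rel_diagram_mult inv_rel_diagram_one)
qed

lemma cup_partitions: "n \<ge> 2 \<Longrightarrow> cup n \<in> partitions n"
  unfolding cup_def by (rule pad_partitions) (auto simp: disjoint_def)

lemma linked_cup:
  "n \<ge> 2 \<Longrightarrow> linked (cup n) u v \<longleftrightarrow> u = v \<and> u \<in> verts n \<or> u \<in> {Up 1, Up 2} \<and> v \<in> {Up 1, Up 2}"
  unfolding cup_def by (subst linked_pad) auto

lemma cup_small_blocks: "\<forall>B\<in>cup n. card B \<le> 2"
  unfolding cup_def by (rule pad_small_blocks) (auto simp: card_insert_if)

lemma cup_planar: "n \<ge> 2 \<Longrightarrow> planar n (cup n)"
  by (auto simp: planar_iff[OF cup_partitions] linked_cup)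

text \<open>The kernel of a partial identity is equality, so its domain consists of all subsets.
  Since the partial identity compares sets only on \<open>A\<close>, the kernel condition says that
  every subset of \<open>A\<close> is the trace of a kernel-saturated set, that is, \<alpha> links
  no two points of \<open>A\<close>.\<close>

lemma Domain_partial_id_mult:
  assumes \<alpha>: "\<alpha> \<in> partitions n" and A: "A \<subseteq> {1..n}"
  shows "ker (partial_id n A) = ker (diagram_mult n (partial_id n A) \<alpha>) \<longleftrightarrow>
    (\<forall>F\<subseteq>A. \<exists>G\<in>Domain (inv_rel n \<alpha>). G \<inter> A = F)"
proof -
  note p = partial_id_partitions[OF A]
  have "Domain (inv_rel n (partial_id n A)) = Pow {1..n}"
    using inv_rel_partial_id[OF A] by (auto simp del: atLeastAtMost_iff)
  moreover have "Domain (inv_rel n (diagram_mult n (partial_id n A) \<alpha>)) =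
      {F. F \<subseteq> {1..n} \<and> (\<exists>G\<in>Domain (inv_rel n \<alpha>). G \<inter> A = F \<inter> A)}"
  proof (rule Set.set_eqI)
    fix F
    have "F \<in> Domain (inv_rel n (partial_id n A) O inv_rel n \<alpha>) \<longleftrightarrow>
        (\<exists>G\<in>Domain (inv_rel n \<alpha>). (F, G) \<in> inv_rel n (partial_id n A))"
      by blast
    also have "\<dots> \<longleftrightarrow> F \<subseteq> {1..n} \<and> (\<exists>G\<in>Domain (inv_rel n \<alpha>). G \<inter> A = F \<inter> A)"
    proof -
      have "(F, G) \<in> inv_rel n (partial_id n A) \<longleftrightarrow> F \<subseteq> {1..n} \<and> G \<inter> A = F \<inter> A"
        if "G \<in> Domain (inv_rel n \<alpha>)" for G
        using that[unfolded Domain_inv_rel[OF \<alpha>]] by (simp only: inv_rel_partial_id[OF A]) metis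
      then show ?thesis
        by (simp cong: bex_cong)
    qed
    finally show "F \<in> Domain (inv_rel n (diagram_mult n (partial_id n A) \<alpha>)) \<longleftrightarrow>
        F \<in> {F. F \<subseteq> {1..n} \<and> (\<exists>G\<in>Domain (inv_rel n \<alpha>). G \<inter> A = F \<inter> A)}"
      by (simp add: inv_rel_diagram_mult[OF p \<alpha>])
  qed
  moreover have "Pow {1..n} = {F. F \<subseteq> {1..n} \<and> (\<exists>G\<in>Domain (inv_rel n \<alpha>). G \<inter> A = F \<inter> A)} \<longleftrightarrow>
    (\<forall>F\<subseteq>A. \<exists>G\<in>Domain (inv_rel n \<alpha>). G \<inter> A = F)" (is "?L \<longleftrightarrow> ?R")
  proof
    assume ?L
    show ?R
    proof (intro allI impI)
      fix F assume F: "F \<subseteq> A"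
      then have "F \<in> Pow {1..n}"
        using A by blast
      then have "\<exists>G\<in>Domain (inv_rel n \<alpha>). G \<inter> A = F \<inter> A"
        using \<open>?L\<close> by blast
      then show "\<exists>G\<in>Domain (inv_rel n \<alpha>). G \<inter> A = F"
        using F by (simp add: Int_absorb2)
    qed
  next
    assume ?R
    then have "\<exists>G\<in>Domain (inv_rel n \<alpha>). G \<inter> A = F \<inter> A" for F
      by simp
    then show ?L
      by blast
  qed
  ultimately show ?thesis
    unfolding ker_eq_iff_Domain[OF p diagram_mult_partitions[OF p \<alpha>]] by simp
qed

lemma inv_rel_conjugate_partial_id:
  assumes \<alpha>: "\<alpha> \<in> partitions n" and A: "A \<subseteq> {1..n}"
  shows "(F, H) \<in> inv_rel n (diagram_mult n (diagram_mult n (star \<alpha>) (partial_id n A)) \<alpha>) \<longleftrightarrow>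
    (\<exists>G G'. (G, F) \<in> inv_rel n \<alpha> \<and> (G', H) \<in> inv_rel n \<alpha> \<and> G \<inter> A = G' \<inter> A)"
proof -
  have eq: "inv_rel n (diagram_mult n (diagram_mult n (star \<alpha>) (partial_id n A)) \<alpha>) =
      ((inv_rel n \<alpha>)\<inverse> O inv_rel n (partial_id n A)) O inv_rel n \<alpha>"
    using \<alpha> partial_id_partitions[OF A] star_partitions[OF \<alpha>]
    by (simp add: inv_rel_diagram_mult diagram_mult_partitions inv_rel_star)
  have id: "(G, G') \<in> inv_rel n (partial_id n A) \<longleftrightarrow> G \<inter> A = G' \<inter> A"
    if "(G, F) \<in> inv_rel n \<alpha>" "(G', H) \<in> inv_rel n \<alpha>" for G G'
    using inv_rel_subset[OF that(1)] inv_rel_subset[OF that(2)] inv_rel_partial_id[OF A] by simp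
  show ?thesis
    unfolding eq
  proof
    assume "(F, H) \<in> ((inv_rel n \<alpha>)\<inverse> O inv_rel n (partial_id n A)) O inv_rel n \<alpha>"
    then obtain G G' where "(G, F) \<in> inv_rel n \<alpha>" "(G, G') \<in> inv_rel n (partial_id n A)"
      "(G', H) \<in> inv_rel n \<alpha>"
      by (elim relcompEpair converseD) auto
    then show "\<exists>G G'. (G, F) \<in> inv_rel n \<alpha> \<and> (G', H) \<in> inv_rel n \<alpha> \<and> G \<inter> A = G' \<inter> A"
      using id by metis
  next
    assume "\<exists>G G'. (G, F) \<in> inv_rel n \<alpha> \<and> (G', H) \<in> inv_rel n \<alpha> \<and> G \<inter> A = G' \<inter> A"
    then obtain G G' where "(G, F) \<in> inv_rel n \<alpha>" "(G', H) \<in> inv_rel n \<alpha>" "G \<inter> A = G' \<inter> A"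
      by metis
    then show "(F, H) \<in> ((inv_rel n \<alpha>)\<inverse> O inv_rel n (partial_id n A)) O inv_rel n \<alpha>"
      using id by (metis converseI relcompI)
  qed
qed

text \<open>If the points are unlinked, the upper part of the block of either one contains it and
  omits the other, while the empty set and the whole row provide the remaining two traces.\<close>

lemma ker_partial_id_pair:
  assumes \<alpha>: "\<alpha> \<in> partitions n" and ij: "{i, j} \<subseteq> {1..n}" "i \<noteq> j"
  shows "ker (partial_id n {i, j}) = ker (diagram_mult n (partial_id n {i, j}) \<alpha>) \<longleftrightarrow>
    \<not> linked \<alpha> (Up i) (Up j)"
  unfolding Domain_partial_id_mult[OF \<alpha> ij(1)]
proof
  assume r: "\<forall>F\<subseteq>{i, j}. \<exists>G\<in>Domain (inv_rel n \<alpha>). G \<inter> {i, j} = F"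
  have "\<exists>G\<in>Domain (inv_rel n \<alpha>). G \<inter> {i, j} = {i}"
    using r[rule_format, of "{i}"] by simp
  then obtain G H where GH: "(G, H) \<in> inv_rel n \<alpha>" "G \<inter> {i, j} = {i}"
    by (elim bexE DomainE) blast
  then have H: "(G, H) \<in> inv_rel n \<alpha>" "i \<in> G" "j \<notin> G"
    using ij(2) by auto
  then show "\<not> linked \<alpha> (Up i) (Up j)"
    using inv_relD[OF H(1), of "Up i" "Up j"] by auto
next
  assume l: "\<not> linked \<alpha> (Up i) (Up j)"
  have cl: "\<exists>G\<in>Domain (inv_rel n \<alpha>). a \<in> G \<and> b \<notin> G"
    if "a \<in> {1..n}" "\<not> linked \<alpha> (Up a) (Up b)" for a b
    using that linked_refl[OF \<alpha>, of "Up a"] DomainI[OF linked_block(1)[OF \<alpha>, of "Up a"]] 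
    by (intro bexI[of _ "{x. linked \<alpha> (Up a) (Up x)}"]) auto
  show "\<forall>F\<subseteq>{i, j}. \<exists>G\<in>Domain (inv_rel n \<alpha>). G \<inter> {i, j} = F"
  proof (intro allI impI)
    fix F assume "F \<subseteq> {i, j}"
    then consider "F = {}" | "F = {i}" | "F = {j}" | "F = {i, j}"
      by blast
    then show "\<exists>G\<in>Domain (inv_rel n \<alpha>). G \<inter> {i, j} = F"
    proof cases
      case 1
      then show ?thesis
        using DomainI[OF inv_rel_empty[of n \<alpha>]] by (intro bexI[of _ "{}"]) auto
    next
      case 2
      then show ?thesis
        using cl[of i j] l ij by fastforce
    next
      case 3
      then show ?thesis
        using cl[of j i] l linked_symD[of \<alpha> "Up j" "Up i"] ij by fastforce
    next
      case 4
      then show ?thesis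
        using DomainI[OF inv_rel_full[OF \<alpha>]] ij(1) by (intro bexI[of _ "{1..n}"]) auto
    qed
  qed
qed

text \<open>A set with at most one point has only trivial subsets, traced by the empty set and the
  whole row. Hence the action never gives the extra point here, and the conjugate is always
  visible.\<close>

lemma ker_partial_id_singleton:
  assumes \<alpha>: "\<alpha> \<in> partitions n" and A: "A \<subseteq> {1..n}" "A \<subseteq> {i}"
  shows "ker (partial_id n A) = ker (diagram_mult n (partial_id n A) \<alpha>)"
  unfolding Domain_partial_id_mult[OF \<alpha> A(1)]
proof (intro allI impI)
  fix F assume "F \<subseteq> A"
  then consider "F = {}" | "F = A"
    using A(2) by blast
  then show "\<exists>G\<in>Domain (inv_rel n \<alpha>). G \<inter> A = F"
  proof cases
    case 1
    then show ?thesis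
      using DomainI[OF inv_rel_empty[of n \<alpha>]] by (intro bexI[of _ "{}"]) auto
  next
    case 2
    then show ?thesis
      using DomainI[OF inv_rel_full[OF \<alpha>]] A(1) by (intro bexI[of _ "{1..n}"]) auto
  qed
qed

text \<open>The conjugate pairs lower traces of invariant sets that agree at \<open>i\<close>. A
  link carries this agreement over to \<open>j\<close>; in the other direction, the block of
  \<open>i\<close> is compared with the whole vertex set.\<close>

lemma linked_Up_Lo_iff:
  assumes \<alpha>: "\<alpha> \<in> partitions n" and i: "i \<in> {1..n}" and j: "j \<in> {1..n}"
  shows "linked \<alpha> (Up i) (Lo j) \<longleftrightarrow>
    (\<forall>(F, H)\<in>inv_rel n (diagram_mult n (diagram_mult n (star \<alpha>) (partial_id n {i})) \<alpha>). j \<in> F \<longleftrightarrow> j \<in> H)"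
    (is "_ \<longleftrightarrow> (\<forall>(F, H)\<in>?C. _)")
proof
  have C: "(F, H) \<in> ?C \<longleftrightarrow>
      (\<exists>G G'. (G, F) \<in> inv_rel n \<alpha> \<and> (G', H) \<in> inv_rel n \<alpha> \<and> (i \<in> G \<longleftrightarrow> i \<in> G'))" for F H
  proof -
    have "G \<inter> {i} = G' \<inter> {i} \<longleftrightarrow> (i \<in> G \<longleftrightarrow> i \<in> G')" for G G'
      by blast
    then show ?thesis
      using inv_rel_conjugate_partial_id[OF \<alpha>, of "{i}" F H] i by simp
  qed
  show "\<forall>(F, H)\<in>?C. j \<in> F \<longleftrightarrow> j \<in> H" if l: "linked \<alpha> (Up i) (Lo j)"
  proof (clarify, unfold C)
    fix F H
    assume "\<exists>G G'. (G, F) \<in> inv_rel n \<alpha> \<and> (G', H) \<in> inv_rel n \<alpha> \<and> (i \<in> G \<longleftrightarrow> i \<in> G')"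
    then show "j \<in> F \<longleftrightarrow> j \<in> H"
      using inv_relD[OF _ l] unfolding join_iff by metis
  qed
  show "linked \<alpha> (Up i) (Lo j)" if r: "\<forall>(F, H)\<in>?C. j \<in> F \<longleftrightarrow> j \<in> H"
  proof -
    have "({y. linked \<alpha> (Up i) (Lo y)}, {1..n}) \<in> ?C"
      unfolding C using linked_block(1)[OF \<alpha>, of "Up i"] inv_rel_full[OF \<alpha>] linked_refl[OF \<alpha>, of "Up i"] i
      by (intro exI[of _ "{x. linked \<alpha> (Up i) (Up x)}"] exI[of _ "{1..n}"]) simp
    then show ?thesis
      using r j by auto
  qed
qed

lemma diagram_eqI_partial_id:
  assumes \<alpha>: "\<alpha> \<in> partitions n" and \<beta>: "\<beta> \<in> partitions n"
    and ker: "\<And>A. A \<subseteq> {1..n} \<Longrightarrow> card A \<le> 2 \<Longrightarrow>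
      ker (partial_id n A) = ker (diagram_mult n (partial_id n A) \<alpha>) \<longleftrightarrow>
      ker (partial_id n A) = ker (diagram_mult n (partial_id n A) \<beta>)"
    and conj: "\<And>A. A \<subseteq> {1..n} \<Longrightarrow> card A \<le> 2 \<Longrightarrow>
      ker (partial_id n A) = ker (diagram_mult n (partial_id n A) \<alpha>) \<Longrightarrow>
      diagram_mult n (diagram_mult n (star \<alpha>) (partial_id n A)) \<alpha> =
      diagram_mult n (diagram_mult n (star \<beta>) (partial_id n A)) \<beta>"
  shows "\<alpha> = \<beta>"
proof -
  have UU: "linked \<alpha> (Up i) (Up j) \<longleftrightarrow> linked \<beta> (Up i) (Up j)" if "i \<in> {1..n}" "j \<in> {1..n}" for i j
  proof (cases "i = j")
    case True
    then show ?thesis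
      by (simp add: linked_refl[OF \<alpha>] linked_refl[OF \<beta>])
  next
    case False
    have "{i, j} \<subseteq> {1..n}" "card {i, j} \<le> 2"
      using that by (auto simp: card_insert_if)
    then show ?thesis
      using ker[of "{i, j}"] ker_partial_id_pair[OF \<alpha> _ False] ker_partial_id_pair[OF \<beta> _ False] by blast
  qed
  have UL: "linked \<alpha> (Up i) (Lo j) \<longleftrightarrow> linked \<beta> (Up i) (Lo j)" if "i \<in> {1..n}" "j \<in> {1..n}" for i j
    using that conj[of "{i}", OF _ _ ker_partial_id_singleton[OF \<alpha>]]
    by (simp add: linked_Up_Lo_iff[OF \<alpha>] linked_Up_Lo_iff[OF \<beta>])
  have LL: "linked \<alpha> (Lo i) (Lo j) \<longleftrightarrow> linked \<beta> (Lo i) (Lo j)" for i j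
  proof -
    \<comment> \<open>For empty \<open>A\<close> the agreement condition is void: the conjugate
      relates any two lower traces of invariant sets, so it retains only the cokernel.\<close>
    have dom: "Domain (inv_rel n (diagram_mult n (diagram_mult n (star \<gamma>) (partial_id n {})) \<gamma>)) =
        Domain (inv_rel n (star \<gamma>))" if "\<gamma> \<in> partitions n" for \<gamma>
      using inv_rel_conjugate_partial_id[OF that, of "{}"] inv_rel_empty[of n \<gamma>]
      by (auto simp: inv_rel_star Domain_iff)
    have "Domain (inv_rel n (star \<alpha>)) = Domain (inv_rel n (star \<beta>))"
      using dom[OF \<alpha>] dom[OF \<beta>] conj[of "{}", OF _ _ ker_partial_id_singleton[OF \<alpha>]] by simp
    then have "ker (star \<alpha>) = ker (star \<beta>)"
      using ker_eq_iff_Domain star_partitions \<alpha> \<beta> by blast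
    then show ?thesis
      using ker_iff[of i j "star \<alpha>"] ker_iff[of i j "star \<beta>"] by (simp add: linked_star)
  qed
  show ?thesis
  proof (rule partitions_eqI[OF \<alpha> \<beta>])
    fix u v
    show "linked \<alpha> u v \<longleftrightarrow> linked \<beta> u v"
    proof (cases "u \<in> verts n \<and> v \<in> verts n")
      case True
      then have "u \<in> verts n" "v \<in> verts n"
        by auto
      then show ?thesis
        by (elim vertsE) (simp_all add: UU UL LL linked_sym[of _ "Lo _" "Up _"])
    next
      case False
      then show ?thesis
        using linked_verts[OF \<alpha>] linked_verts[OF \<beta>] by blast
    qed
  qed
qed

section \<open>The action on projections\<close>

text \<open>\<open>K\<close> and \<open>K'\<close> agree on representatives of the transversal
  blocks, so their difference meets only blocks without lower vertices and is related to the empty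
  set. Adding this pair replaces \<open>K\<close> by \<open>K'\<close> as the partner of
  \<open>F\<close>; symmetry and idempotence of \<delta> then compose \<open>F\<close> with
  \<open>H\<close>.\<close>

lemma inv_rel_projection_absorb:
  assumes \<delta>: "\<delta> \<in> partitions n" and idem: "diagram_mult n \<delta> \<delta> = \<delta>" and star: "star \<delta> = \<delta>"
    and X: "\<And>B y. B \<in> \<delta> \<Longrightarrow> \<exists>x. Up x \<in> B \<Longrightarrow> Lo y \<in> B \<Longrightarrow> \<exists>x\<in>X. Up x \<in> B"
    and KF: "(K, F) \<in> inv_rel n \<delta>" and KH: "(K', H) \<in> inv_rel n \<delta>" and KX: "K \<inter> X = K' \<inter> X"
  shows "(F, H) \<in> inv_rel n \<delta>"
proof -
  have K: "a \<in> K \<longleftrightarrow> b \<in> K" "a \<in> K' \<longleftrightarrow> b \<in> K'" if "linked \<delta> (Up a) (Up b)" for a b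
    using inv_relD[OF KF that] inv_relD[OF KH that] by simp_all
  have "(sym_diff K K', {}) \<in> inv_rel n \<delta>"
  proof (rule inv_relI)
    show "v \<in> join (sym_diff K K') {}" if uv: "linked \<delta> u v" "u \<in> join (sym_diff K K') {}" for u v
    proof -
      obtain a where a: "u = Up a" "a \<in> K \<longleftrightarrow> a \<notin> K'"
        using uv(2) by (auto simp: join_def)
      show ?thesis
      proof (cases v)
        case (Up b)
        then show ?thesis
          using K[of a b] uv(1) a by auto
      next
        case (Lo b)
        then obtain B where B: "B \<in> \<delta>" "Up a \<in> B" "Lo b \<in> B"
          using uv(1) a by (auto simp: linked_def)
        then obtain x where x: "x \<in> X" "Up x \<in> B"
          using X by blast
        then have "linked \<delta> (Up a) (Up x)"
          using B by (auto simp: linked_def)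
        moreover have "x \<in> K \<longleftrightarrow> x \<in> K'"
          using KX x(1) by blast
        ultimately show ?thesis
          using K[of a x] a(2) by simp
      next
        case (Mid b)
        then show ?thesis
          using linked_verts[OF \<delta> uv(1)] by simp
      qed
    qed
    show "sym_diff K K' \<subseteq> {1..n}"
      using inv_rel_subset[OF KF] inv_rel_subset[OF KH] by blast
  qed simp
  moreover have "sym_diff K (sym_diff K K') = K'" "sym_diff F {} = F"
    by auto
  ultimately have "(K', F) \<in> inv_rel n \<delta>"
    using inv_rel_sym_diff[OF KF] by metis
  then have "(F, K') \<in> inv_rel n \<delta>"
    using inv_rel_star[of n \<delta>] star by auto
  then have "(F, H) \<in> inv_rel n (diagram_mult n \<delta> \<delta>)"
    unfolding inv_rel_diagram_mult[OF \<delta> \<delta>] using KH by blast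
  then show ?thesis
    by (simp add: idem)
qed

lemma transversal_representatives:
  assumes \<delta>: "\<delta> \<in> partitions n"
  obtains X where "X \<subseteq> {1..n}" "card X \<le> rank \<delta>"
    "\<And>B y. B \<in> \<delta> \<Longrightarrow> \<exists>x. Up x \<in> B \<Longrightarrow> Lo y \<in> B \<Longrightarrow> \<exists>x\<in>X. Up x \<in> B"
    "\<And>x y. x \<in> X \<Longrightarrow> y \<in> X \<Longrightarrow> linked \<delta> (Up x) (Up y) \<Longrightarrow> x = y"
proof -
  let ?T = "{B \<in> \<delta>. (\<exists>x. Up x \<in> B) \<and> (\<exists>y. Lo y \<in> B)}"
  define r where "r B = (SOME x. Up x \<in> B)" for B
  have r: "Up (r B) \<in> B" if "B \<in> ?T" for B
    using that someI_ex[of "\<lambda>x. Up x \<in> B"] unfolding r_def by blast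
  show thesis
  proof (rule that[of "r ` ?T"])
    show "r ` ?T \<subseteq> {1..n}"
    proof (rule image_subsetI)
      fix B assume "B \<in> ?T"
      then have "linked \<delta> (Up (r B)) (Up (r B))"
        using r unfolding linked_def by blast
      then show "r B \<in> {1..n}"
        using linked_verts[OF \<delta>] by fastforce
    qed
    show "card (r ` ?T) \<le> rank \<delta>"
      unfolding rank_def using finite_elements[of "verts n" \<delta>] \<delta>
      by (intro card_image_le) (simp add: partitions_def)
    show "\<exists>x\<in>r ` ?T. Up x \<in> B" if "B \<in> \<delta>" "\<exists>x. Up x \<in> B" "Lo y \<in> B" for B y
      using r[of B] that by blast
    show "x = y" if xy: "x \<in> r ` ?T" "y \<in> r ` ?T" "linked \<delta> (Up x) (Up y)" for x y
    proof -
      obtain A B where AB: "A \<in> ?T" "x = r A" "B \<in> ?T" "y = r B"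
        using xy by blast
      then have "Up y \<in> A"
        using linked_blockD[OF \<delta> xy(3), of A] r by blast
      then have "A = B"
        using blocks_eq[OF \<delta>, of A B "Up y"] AB r by blast
      then show ?thesis
        using AB by simp
    qed
  qed
qed

text \<open>Listing \<open>X\<close> in increasing order keeps the strands planar; the source
  \<open>{1, 2}\<close> is the support of the generator.\<close>

lemma monotone_enumeration_card_le_2:
  assumes "n \<ge> 2" "X \<subseteq> {1..n}" "card X \<le> 2"
  obtains T where "T \<subseteq> {1, 2} \<times> {1..n}" "Range T = X" "partial_injection n T"
    "\<And>x y x' y'. (x, y) \<in> T \<Longrightarrow> (x', y') \<in> T \<Longrightarrow> x < x' \<Longrightarrow> y < y'"
proof -
  have "finite X"
    using assms(2) finite_subset by blast
  then consider "X = {}" | a where "X = {a}" | a b where "X = {a, b}" "a < b"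
  proof -
    have "card X = 0 \<or> card X = 1 \<or> card X = 2"
      using assms(3) by linarith
    then have "X = {} \<or> (\<exists>a. X = {a}) \<or> (\<exists>a b. X = {a, b} \<and> a \<noteq> b)"
      using \<open>finite X\<close> by (metis card_0_eq card_1_singletonE card_2_iff)
    moreover have "\<exists>c d. {a, b} = {c, d} \<and> c < d" if "a \<noteq> b" for a b :: nat
      using that by (metis insert_commute nat_neq_iff)
    ultimately show thesis
      using that by metis
  qed
  then show thesis
  proof cases
    case 1
    then show ?thesis
      by (intro that[of "{}"]) (auto simp: partial_injection_def)
  next
    case 2
    then show ?thesis
      using assms by (intro that[of "{(1, a)}"]) (auto simp: partial_injection_def)
  next
    case 3
    then show ?thesis
      using assms by (intro that[of "{(1, a), (2, b)}"]) (auto simp: partial_injection_def)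
  qed
qed

text \<open>The representatives serve twice: being pairwise unlinked they give the kernel condition,
  and meeting every transversal block they allow \<delta> to be recovered.\<close>

lemma projection_factorisation:
  assumes \<delta>: "\<delta> \<in> partitions n" and idem: "diagram_mult n \<delta> \<delta> = \<delta>" and star: "star \<delta> = \<delta>"
    and rank: "rank \<delta> \<le> 2" and n: "n \<ge> 2"
  obtains T where "partial_injection n T"
    "\<And>x y x' y'. (x, y) \<in> T \<Longrightarrow> (x', y') \<in> T \<Longrightarrow> x < x' \<Longrightarrow> y < y'"
    "let \<alpha> = diagram_mult n (strands n T) \<delta>; \<epsilon> = partial_id n {1, 2} in
      ker \<epsilon> = ker (diagram_mult n \<epsilon> \<alpha>) \<and> diagram_mult n (diagram_mult n (star \<alpha>) \<epsilon>) \<alpha> = \<delta>"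
proof -
  obtain X where X: "X \<subseteq> {1..n}" "card X \<le> rank \<delta>"
    and hit: "\<And>B y. B \<in> \<delta> \<Longrightarrow> \<exists>x. Up x \<in> B \<Longrightarrow> Lo y \<in> B \<Longrightarrow> \<exists>x\<in>X. Up x \<in> B"
    and unlinked: "\<And>x y. x \<in> X \<Longrightarrow> y \<in> X \<Longrightarrow> linked \<delta> (Up x) (Up y) \<Longrightarrow> x = y"
    using transversal_representatives[OF \<delta>] by blast
  have "card X \<le> 2"
    using X(2) rank by linarith
  then obtain T where T: "T \<subseteq> {1, 2} \<times> {1..n}" "Range T = X" and pi: "partial_injection n T"
    and mono: "\<And>x y x' y'. (x, y) \<in> T \<Longrightarrow> (x', y') \<in> T \<Longrightarrow> x < x' \<Longrightarrow> y < y'"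
    using monotone_enumeration_card_le_2[OF n X(1)] by metis
  interpret partial_injection n T by (fact pi)
  let ?\<alpha> = "diagram_mult n (strands n T) \<delta>" and ?\<epsilon> = "partial_id n {1, 2}"
  have \<alpha>: "?\<alpha> \<in> partitions n"
    by (simp add: diagram_mult_partitions strands_partitions \<delta>)
  have A: "{1, 2} \<subseteq> {1..n}"
    using n by auto
  have inv_\<alpha>: "(G, F) \<in> inv_rel n ?\<alpha> \<longleftrightarrow>
      (\<exists>K. (G, K) \<in> inv_rel n (strands n T) \<and> (K, F) \<in> inv_rel n \<delta>)" for G F
    by (auto simp: inv_rel_diagram_mult[OF strands_partitions \<delta>])
  have "ker ?\<epsilon> = ker (diagram_mult n ?\<epsilon> ?\<alpha>)"
    unfolding Domain_partial_id_mult[OF \<alpha> A]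
  proof (intro allI impI)
    fix F :: "nat set" assume F: "F \<subseteq> {1, 2}"
    \<comment> \<open>\<open>K\<close> is the union of the upper blocks of \<delta> at the ends of
      the strands from \<open>F\<close>. Different strands end in different blocks, so along
      \<open>T\<close> the set \<open>K\<close> corresponds exactly to \<open>F\<close>.\<close>
    define K where "K = {y. \<exists>x\<in>F. \<exists>z. (x, z) \<in> T \<and> linked \<delta> (Up z) (Up y)}"
    have "K \<in> Domain (inv_rel n \<delta>)"
      unfolding Domain_inv_rel[OF \<delta>]
    proof
      show "K \<subseteq> {1..n}"
        using linked_verts[OF \<delta>, of "Up _" "Up _"] by (fastforce simp: K_def)
      show "\<forall>(x, y)\<in>ker \<delta>. x \<in> K \<longrightarrow> y \<in> K"
        unfolding K_def using linked_trans[OF \<delta>] by (fastforce simp: ker_iff)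
    qed
    then obtain H where KH: "(K, H) \<in> inv_rel n \<delta>"
      by blast
    have "x \<in> F \<longleftrightarrow> y \<in> K" if xy: "(x, y) \<in> T" for x y
    proof
      assume "x \<in> F"
      moreover have "linked \<delta> (Up y) (Up y)"
        using xy T_subset linked_refl[OF \<delta>, of "Up y"] by auto
      ultimately show "y \<in> K"
        using xy unfolding K_def by blast
    next
      assume "y \<in> K"
      then obtain x' z where z: "x' \<in> F" "(x', z) \<in> T" "linked \<delta> (Up z) (Up y)"
        unfolding K_def by blast
      moreover have "z = y"
        using unlinked z xy T(2) by blast
      ultimately show "x \<in> F"
        using T_inject[OF xy z(2)] by blast
    qed
    moreover have "F \<subseteq> {1..n}"
      using F A by blast
    ultimately have "(F, K) \<in> inv_rel n (strands n T)"
      using inv_rel_subset[OF KH] unfolding inv_rel_strands by blast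
    then have "F \<in> Domain (inv_rel n ?\<alpha>)"
      using inv_\<alpha> KH by blast
    then show "\<exists>G\<in>Domain (inv_rel n ?\<alpha>). G \<inter> {1, 2} = F"
      using F by blast
  qed
  moreover have "diagram_mult n (diagram_mult n (star ?\<alpha>) ?\<epsilon>) ?\<alpha> = \<delta>"
  proof (rule inv_rel_inject[of _ n])
    show "inv_rel n (diagram_mult n (diagram_mult n (star ?\<alpha>) ?\<epsilon>) ?\<alpha>) = inv_rel n \<delta>"
    proof (intro equalityI subrelI)
      fix F H assume "(F, H) \<in> inv_rel n (diagram_mult n (diagram_mult n (star ?\<alpha>) ?\<epsilon>) ?\<alpha>)"
      then obtain G G' K K' where GK: "(G, K) \<in> inv_rel n (strands n T)" "(K, F) \<in> inv_rel n \<delta>"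
        "(G', K') \<in> inv_rel n (strands n T)" "(K', H) \<in> inv_rel n \<delta>" and G: "G \<inter> {1, 2} = G' \<inter> {1, 2}"
        unfolding inv_rel_conjugate_partial_id[OF \<alpha> A] inv_\<alpha> by metis
      \<comment> \<open>Each representative is the end of a strand starting in
        \<open>{1, 2}\<close>, where \<open>G\<close> and \<open>G'\<close> agree.\<close>
      have "y \<in> K \<longleftrightarrow> y \<in> K'" if "y \<in> X" for y
      proof -
        obtain x where x: "(x, y) \<in> T"
          using T(2) \<open>y \<in> X\<close> by blast
        then have "x \<in> G \<longleftrightarrow> x \<in> G'"
          using G T(1) by blast
        then show ?thesis
          using GK(1,3) x unfolding inv_rel_strands by blast
      qed
      then have "K \<inter> X = K' \<inter> X"
        by blast
      then show "(F, H) \<in> inv_rel n \<delta>"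
        by (intro inv_rel_projection_absorb[OF \<delta> idem star _ GK(2,4), where X = X] hit)
    next
      fix F H assume "(F, H) \<in> inv_rel n \<delta>"
      then have "(F, H) \<in> inv_rel n (diagram_mult n \<delta> \<delta>)"
        by (simp add: idem)
      then obtain K where K: "(F, K) \<in> inv_rel n \<delta>" "(K, H) \<in> inv_rel n \<delta>"
        unfolding inv_rel_diagram_mult[OF \<delta> \<delta>] by blast
      then have KF: "(K, F) \<in> inv_rel n \<delta>"
        using inv_rel_star[of n \<delta>] star by auto
      \<comment> \<open>The pullback of \<open>K\<close> along the strands serves as both upper sets
        \<open>G\<close> and \<open>G'\<close> of the conjugation formula.\<close>
      define G where "G = {x. \<exists>y\<in>K. (x, y) \<in> T}"
      have "G \<subseteq> {1..n}"
        using T_subset unfolding G_def by blast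
      moreover have "x \<in> G \<longleftrightarrow> y \<in> K" if "(x, y) \<in> T" for x y
        using that T_inject unfolding G_def by blast
      ultimately have "(G, K) \<in> inv_rel n (strands n T)"
        using inv_rel_subset[OF KF] unfolding inv_rel_strands by blast
      then show "(F, H) \<in> inv_rel n (diagram_mult n (diagram_mult n (star ?\<alpha>) ?\<epsilon>) ?\<alpha>)"
        unfolding inv_rel_conjugate_partial_id[OF \<alpha> A] inv_\<alpha> using K(2) KF by blast
    qed
  qed (simp_all add: \<alpha> \<delta> diagram_mult_partitions star_partitions partial_id_partitions[OF A] del: One_nat_def)
  ultimately show thesis
    using that[OF pi mono] by (simp add: Let_def)
qed

section \<open>Closure properties shared by the four monoids\<close>

locale diagram_class =
  fixes n :: nat and D :: "diagram set"
  assumes n_ge_2: "n \<ge> 2"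
    and partitions: "\<alpha> \<in> D \<Longrightarrow> \<alpha> \<in> partitions n"
    and mult_closed: "\<alpha> \<in> D \<Longrightarrow> \<beta> \<in> D \<Longrightarrow> diagram_mult n \<alpha> \<beta> \<in> D"
    and star_closed: "\<alpha> \<in> D \<Longrightarrow> star \<alpha> \<in> D"
    and strands_closed: "partial_injection n T \<Longrightarrow>
      (\<And>x y x' y'. (x, y) \<in> T \<Longrightarrow> (x', y') \<in> T \<Longrightarrow> x < x' \<Longrightarrow> y < y') \<Longrightarrow> strands n T \<in> D"
    and cup_closed: "cup n \<in> D"
begin

abbreviation mult (infixl \<open>\<odot>\<close> 70) where
  "\<alpha> \<odot> \<beta> \<equiv> diagram_mult n \<alpha> \<beta>"

lemma finite_D: "finite D"
  using partitions finite_subset[OF _ finite_partitions[of n]] by blast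

lemma partial_id_closed: "A \<subseteq> {1..n} \<Longrightarrow> partial_id n A \<in> D"
  by (rule strands_closed[OF partial_injection_Id_on]) auto

lemma one_closed: "diagram_one n \<in> D"
  by (simp add: diagram_one_eq partial_id_closed)

lemma mult_assoc: "\<alpha> \<in> D \<Longrightarrow> \<beta> \<in> D \<Longrightarrow> \<gamma> \<in> D \<Longrightarrow> \<alpha> \<odot> \<beta> \<odot> \<gamma> = \<alpha> \<odot> (\<beta> \<odot> \<gamma>)"
  by (simp add: diagram_mult_assoc partitions)

lemma star_mult: "\<alpha> \<in> D \<Longrightarrow> \<beta> \<in> D \<Longrightarrow> star (\<alpha> \<odot> \<beta>) = star \<beta> \<odot> star \<alpha>"
  by (simp add: star_diagram_mult partitions)

lemma monoid_diagram_monoid: "monoid (diagram_monoid n D)"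
  by (rule monoidI)
    (simp_all add: diagram_monoid_def mult_closed one_closed mult_assoc diagram_one_mult partitions)

definition proj :: "diagram set" where
  "proj = {\<epsilon> \<in> D. \<epsilon> \<odot> \<epsilon> = \<epsilon> \<and> \<epsilon> = star \<epsilon>}"

lemma projD:
  assumes "\<epsilon> \<in> proj"
  shows "\<epsilon> \<in> D" "\<epsilon> \<odot> \<epsilon> = \<epsilon>" "star \<epsilon> = \<epsilon>"
  using assms by (auto simp: proj_def)

lemma partial_id_proj:
  assumes A: "A \<subseteq> {1..n}"
  shows "partial_id n A \<in> proj"
proof -
  note p = partial_id_partitions[OF A]
  have "(F, G) \<in> inv_rel n (partial_id n A) O inv_rel n (partial_id n A) \<longleftrightarrow> 
      (F, G) \<in> inv_rel n (partial_id n A)" for F G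
    unfolding relcomp_unfold by (auto simp: inv_rel_partial_id[OF A] simp del: atLeastAtMost_iff)
  then have "partial_id n A \<odot> partial_id n A = partial_id n A"
    by (intro inv_rel_inject[of _ n]) (auto simp: p diagram_mult_partitions inv_rel_diagram_mult)
  moreover have "(F, G) \<in> inv_rel n (star (partial_id n A)) \<longleftrightarrow> 
      (F, G) \<in> inv_rel n (partial_id n A)" for F G
    unfolding inv_rel_star by (auto simp: inv_rel_partial_id[OF A] simp del: atLeastAtMost_iff)
  then have "star (partial_id n A) = partial_id n A"
    by (intro inv_rel_inject[of _ n]) (auto simp: p star_partitions)
  ultimately show ?thesis
    using partial_id_closed[OF A] by (simp add: proj_def)
qed

lemma rank_partial_id:
  assumes A: "A \<subseteq> {1..n}"
  shows "rank (partial_id n A) \<le> card A"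
proof -
  have "finite A"
    using A finite_subset by blast
  moreover have "Id_on A = (\<lambda>x. (x, x)) ` A"
    by auto
  moreover have "card ((\<lambda>x. (x, x)) ` A) = card A"
    by (rule card_image) (simp add: inj_on_def)
  ultimately show ?thesis
    using partial_injection.rank_strands[OF partial_injection_Id_on[OF A]] by simp
qed

lemma conjugate_eq:
  assumes "\<epsilon> \<in> proj" "\<alpha> \<in> D"
  shows "star \<alpha> \<odot> \<epsilon> \<odot> \<alpha> = star (\<epsilon> \<odot> \<alpha>) \<odot> (\<epsilon> \<odot> \<alpha>)"
proof -
  have "star (\<epsilon> \<odot> \<alpha>) \<odot> (\<epsilon> \<odot> \<alpha>) = star \<alpha> \<odot> (\<epsilon> \<odot> \<epsilon>) \<odot> \<alpha>"
    using projD(1,3)[OF assms(1)] assms(2) by (simp add: star_mult star_closed mult_closed mult_assoc)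
  then show ?thesis
    by (simp add: projD[OF assms(1)])
qed

lemma mult_star_mult: "\<gamma> \<in> D \<Longrightarrow> \<gamma> \<odot> (star \<gamma> \<odot> \<gamma>) = \<gamma>"
  using diagram_mult_star_mult[of \<gamma> n] by (simp add: mult_assoc star_closed partitions)

lemma star_mult_proj:
  assumes \<gamma>: "\<gamma> \<in> D"
  shows "star \<gamma> \<odot> \<gamma> \<in> proj"
proof -
  have "star \<gamma> \<odot> \<gamma> \<odot> (star \<gamma> \<odot> \<gamma>) = star \<gamma> \<odot> (\<gamma> \<odot> (star \<gamma> \<odot> \<gamma>))"
    by (simp add: mult_assoc star_closed mult_closed \<gamma>)
  then show ?thesis
    by (simp add: proj_def mult_star_mult star_mult star_closed mult_closed \<gamma>)
qed

text \<open>Put \<gamma> = \<epsilon> \<odot> \<alpha>. Left multiplication by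
  \<open>star \<gamma>\<close> and by \<gamma> carries each kernel equation to the other, since
  \<gamma> \<odot> (star \<gamma> \<odot> \<gamma>) = \<gamma>. This matches the case distinctions
  on the two sides of the action law.\<close>

lemma ker_conjugate_iff:
  assumes \<epsilon>: "\<epsilon> \<in> proj" and \<alpha>: "\<alpha> \<in> D" and \<beta>: "\<beta> \<in> D" and ker: "ker \<epsilon> = ker (\<epsilon> \<odot> \<alpha>)"
  shows "ker (star \<alpha> \<odot> \<epsilon> \<odot> \<alpha>) = ker (star \<alpha> \<odot> \<epsilon> \<odot> \<alpha> \<odot> \<beta>) \<longleftrightarrow> ker \<epsilon> = ker (\<epsilon> \<odot> (\<alpha> \<odot> \<beta>))"
proof -
  define \<gamma> where "\<gamma> = \<epsilon> \<odot> \<alpha>"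
  have \<gamma>: "\<gamma> \<in> D"
    unfolding \<gamma>_def using projD(1)[OF \<epsilon>] \<alpha> by (rule mult_closed)
  have cong: "ker (\<zeta> \<odot> \<eta>) = ker (\<zeta> \<odot> \<theta>)" if "\<zeta> \<in> D" "\<eta> \<in> D" "\<theta> \<in> D" "ker \<eta> = ker \<theta>" for \<zeta> \<eta> \<theta>
    using that by (simp add: ker_mult_left_cong partitions)
  have "ker (star \<gamma> \<odot> \<gamma>) = ker (star \<gamma> \<odot> \<gamma> \<odot> \<beta>) \<longleftrightarrow> ker \<gamma> = ker (\<gamma> \<odot> \<beta>)"
  proof
    assume "ker (star \<gamma> \<odot> \<gamma>) = ker (star \<gamma> \<odot> \<gamma> \<odot> \<beta>)"
    then have "ker (\<gamma> \<odot> (star \<gamma> \<odot> \<gamma>)) = ker (\<gamma> \<odot> (star \<gamma> \<odot> \<gamma> \<odot> \<beta>))"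
      by (intro cong) (simp_all add: \<gamma> \<beta> mult_closed star_closed)
    moreover have "\<gamma> \<odot> (star \<gamma> \<odot> \<gamma> \<odot> \<beta>) = \<gamma> \<odot> (star \<gamma> \<odot> \<gamma>) \<odot> \<beta>"
      by (simp add: \<gamma> \<beta> mult_closed star_closed mult_assoc)
    ultimately show "ker \<gamma> = ker (\<gamma> \<odot> \<beta>)"
      by (simp only: mult_star_mult[OF \<gamma>])
  next
    assume "ker \<gamma> = ker (\<gamma> \<odot> \<beta>)"
    then have "ker (star \<gamma> \<odot> \<gamma>) = ker (star \<gamma> \<odot> (\<gamma> \<odot> \<beta>))"
      by (intro cong) (simp_all add: \<gamma> \<beta> mult_closed star_closed)
    then show "ker (star \<gamma> \<odot> \<gamma>) = ker (star \<gamma> \<odot> \<gamma> \<odot> \<beta>)"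
      by (simp add: \<gamma> \<beta> star_closed mult_assoc)
  qed
  moreover have "\<epsilon> \<odot> (\<alpha> \<odot> \<beta>) = \<gamma> \<odot> \<beta>"
    unfolding \<gamma>_def using projD(1)[OF \<epsilon>] \<alpha> \<beta> by (simp add: mult_assoc)
  ultimately show ?thesis
    unfolding conjugate_eq[OF \<epsilon> \<alpha>] ker by (simp only: \<gamma>_def)
qed

end

section \<open>The action law, faithfulness and generation\<close>

locale projection_action = diagram_class +
  fixes M Q Qm and \<mu> :: "diagram option \<Rightarrow> diagram \<Rightarrow> diagram option"
  assumes M: "M = diagram_monoid n D"
    and Q: "Q = {\<epsilon> \<in> proj. rank \<epsilon> \<le> 2}"
    and Qm: "Qm = Some ` Q \<union> {None}"
    and \<mu>_Some: "\<And>\<epsilon> \<alpha>. \<epsilon> \<in> Q \<Longrightarrow> \<alpha> \<in> D \<Longrightarrow>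
      \<mu> (Some \<epsilon>) \<alpha> = (if ker \<epsilon> = ker (\<epsilon> \<odot> \<alpha>) then Some (star \<alpha> \<odot> \<epsilon> \<odot> \<alpha>) else None)"
    and \<mu>_None: "\<And>\<alpha>. \<alpha> \<in> D \<Longrightarrow> \<mu> None \<alpha> = None"
begin

lemma M_simps: "carrier M = D" "\<alpha> \<otimes>\<^bsub>M\<^esub> \<beta> = \<alpha> \<odot> \<beta>"
  by (simp_all add: M diagram_monoid_def)

lemma conjugate_Q:
  assumes \<epsilon>: "\<epsilon> \<in> Q" and \<alpha>: "\<alpha> \<in> D"
  shows "star \<alpha> \<odot> \<epsilon> \<odot> \<alpha> \<in> Q"
proof -
  have p: "\<epsilon> \<in> proj" "rank \<epsilon> \<le> 2"
    using \<epsilon> by (simp_all add: Q)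
  have D: "\<epsilon> \<in> partitions n" "\<alpha> \<in> partitions n" "star \<alpha> \<in> partitions n" "star \<alpha> \<odot> \<epsilon> \<in> partitions n"
    using projD(1)[OF p(1)] \<alpha> by (simp_all add: partitions star_closed mult_closed)
  have "star \<alpha> \<odot> \<epsilon> \<odot> \<alpha> \<in> proj"
    unfolding conjugate_eq[OF p(1) \<alpha>] using projD(1)[OF p(1)] \<alpha> by (intro star_mult_proj mult_closed)
  moreover have "rank (star \<alpha> \<odot> \<epsilon> \<odot> \<alpha>) \<le> rank \<epsilon>"
    using rank_mult_le_left[OF D(4,2)] rank_mult_le_right[OF D(3,1)] by linarith
  ultimately show ?thesis
    using p(2) by (simp add: Q)
qed

lemma \<mu>_closed: "x \<in> Qm \<Longrightarrow> \<alpha> \<in> D \<Longrightarrow> \<mu> x \<alpha> \<in> Qm"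
  by (auto simp: Qm \<mu>_Some \<mu>_None conjugate_Q)

lemma \<mu>_comp:
  assumes "x \<in> Qm" and \<alpha>: "\<alpha> \<in> D" and \<beta>: "\<beta> \<in> D"
  shows "\<mu> (\<mu> x \<alpha>) \<beta> = \<mu> x (\<alpha> \<odot> \<beta>)"
proof (cases x)
  case None
  then show ?thesis
    by (simp add: \<mu>_None \<alpha> \<beta> mult_closed)
next
  case (Some \<epsilon>)
  then have \<epsilon>Q: "\<epsilon> \<in> Q"
    using assms(1) by (auto simp: Qm)
  then have \<epsilon>: "\<epsilon> \<in> proj"
    by (simp add: Q)
  note \<epsilon>D = projD(1)[OF \<epsilon>]
  show ?thesis
  proof (cases "ker \<epsilon> = ker (\<epsilon> \<odot> \<alpha>)")
    case True
    have "star \<beta> \<odot> (star \<alpha> \<odot> \<epsilon> \<odot> \<alpha>) \<odot> \<beta> = star (\<alpha> \<odot> \<beta>) \<odot> \<epsilon> \<odot> (\<alpha> \<odot> \<beta>)"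
      using \<epsilon>D \<alpha> \<beta> by (simp add: star_mult star_closed mult_closed mult_assoc)
    then show ?thesis
      using ker_conjugate_iff[OF \<epsilon> \<alpha> \<beta> True] True \<epsilon>Q \<alpha> \<beta>
      by (simp add: Some \<mu>_Some conjugate_Q mult_closed)
  next
    case False
    \<comment> \<open>Kernels only grow under right multiplication, so a kernel already enlarged by
      \<alpha> stays enlarged and both sides are \<open>None\<close>.\<close>
    have "ker \<epsilon> \<subseteq> ker (\<epsilon> \<odot> \<alpha>)" "ker (\<epsilon> \<odot> \<alpha>) \<subseteq> ker (\<epsilon> \<odot> \<alpha> \<odot> \<beta>)"
      using \<epsilon>D \<alpha> \<beta> by (simp_all only: ker_subset_ker_mult partitions mult_closed)
    then have "ker \<epsilon> \<noteq> ker (\<epsilon> \<odot> (\<alpha> \<odot> \<beta>))"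
      using False \<epsilon>D \<alpha> \<beta> by (auto simp: mult_assoc)
    then show ?thesis
      using False \<epsilon>Q \<alpha> \<beta> by (simp add: Some \<mu>_Some \<mu>_None mult_closed)
  qed
qed

lemma right_action: "right_action M Qm \<mu>"
  by (simp add: right_action_def M_simps \<mu>_closed \<mu>_comp)

lemma partial_id_Q: "A \<subseteq> {1..n} \<Longrightarrow> card A \<le> 2 \<Longrightarrow> partial_id n A \<in> Q"
  using rank_partial_id[of A] partial_id_proj[of A] by (simp add: Q)

lemma faithful_action: "faithful_action M Qm \<mu>"
  unfolding faithful_action_def M_simps
proof (intro ballI impI, rule ccontr)
  fix \<alpha> \<beta> assume \<alpha>: "\<alpha> \<in> D" and \<beta>: "\<beta> \<in> D" and ne: "\<alpha> \<noteq> \<beta>" 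
    and "\<not> (\<exists>x\<in>Qm. \<mu> x \<alpha> \<noteq> \<mu> x \<beta>)"
  then have eq: "\<mu> (Some (partial_id n A)) \<alpha> = \<mu> (Some (partial_id n A)) \<beta>"
    if "A \<subseteq> {1..n}" "card A \<le> 2" for A
    using partial_id_Q[OF that] by (auto simp: Qm)
  have "\<alpha> = \<beta>"
  proof (rule diagram_eqI_partial_id[OF partitions[OF \<alpha>] partitions[OF \<beta>]])
    fix A assume A: "A \<subseteq> {1..n}" "card A \<le> 2"
    note e = eq[OF A, unfolded \<mu>_Some[OF partial_id_Q[OF A] \<alpha>] \<mu>_Some[OF partial_id_Q[OF A] \<beta>]]
    show iff: "ker (partial_id n A) = ker (partial_id n A \<odot> \<alpha>) \<longleftrightarrow>
        ker (partial_id n A) = ker (partial_id n A \<odot> \<beta>)"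
      using e by (metis option.distinct(1))
    show "star \<alpha> \<odot> partial_id n A \<odot> \<alpha> = star \<beta> \<odot> partial_id n A \<odot> \<beta>"
      if "ker (partial_id n A) = ker (partial_id n A \<odot> \<alpha>)"
      using e that iff by (metis option.inject)
  qed
  with ne show False ..
qed

lemma monogenic_action: "monogenic_action M Qm \<mu>"
  unfolding monogenic_action_def M_simps
proof (rule bexI)
  let ?\<epsilon> = "partial_id n {1, 2}"
  have A: "{1, 2} \<subseteq> {1..n}" "card {1, 2 :: nat} \<le> 2"
    using n_ge_2 by auto
  note \<epsilon> = partial_id_Q[OF A]
  show \<epsilon>_Qm: "Some ?\<epsilon> \<in> Qm"
    using \<epsilon> by (simp add: Qm)
  show "Qm = {Some ?\<epsilon>} \<union> {\<mu> (Some ?\<epsilon>) \<alpha> | \<alpha>. \<alpha> \<in> D}"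
  proof
    show "{Some ?\<epsilon>} \<union> {\<mu> (Some ?\<epsilon>) \<alpha> | \<alpha>. \<alpha> \<in> D} \<subseteq> Qm"
      using \<epsilon>_Qm \<mu>_closed by blast
    show "Qm \<subseteq> {Some ?\<epsilon>} \<union> {\<mu> (Some ?\<epsilon>) \<alpha> | \<alpha>. \<alpha> \<in> D}"
    proof
      fix x assume x: "x \<in> Qm"
      have "\<exists>\<alpha>\<in>D. \<mu> (Some ?\<epsilon>) \<alpha> = x"
      proof (cases x)
        case None
        have "linked (cup n) (Up 1) (Up 2)"
          using n_ge_2 by (simp add: linked_cup)
        then have "ker ?\<epsilon> \<noteq> ker (?\<epsilon> \<odot> cup n)"
          using ker_partial_id_pair[OF partitions[OF cup_closed] A(1)] by simp
        then show ?thesis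
          using None cup_closed by (intro bexI[of _ "cup n"]) (simp_all add: \<mu>_Some[OF \<epsilon>] del: One_nat_def)
      next
        case (Some \<delta>)
        then have \<delta>: "\<delta> \<in> proj" "rank \<delta> \<le> 2"
          using x by (auto simp: Qm Q)
        have "\<delta> \<in> partitions n"
          using projD(1)[OF \<delta>(1)] by (rule partitions)
        then obtain T where T: "partial_injection n T"
          "\<And>x y x' y'. (x, y) \<in> T \<Longrightarrow> (x', y') \<in> T \<Longrightarrow> x < x' \<Longrightarrow> y < y'" and
          \<alpha>: "ker ?\<epsilon> = ker (?\<epsilon> \<odot> (strands n T \<odot> \<delta>))"
            "star (strands n T \<odot> \<delta>) \<odot> ?\<epsilon> \<odot> (strands n T \<odot> \<delta>) = \<delta>"
          by (rule projection_factorisation[OF _ projD(2,3)[OF \<delta>(1)] \<delta>(2) n_ge_2])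
            (simp_all only: Let_def)
        have "strands n T \<odot> \<delta> \<in> D"
          using T projD(1)[OF \<delta>(1)] by (intro mult_closed strands_closed)
        then show ?thesis
          using \<alpha> Some by (intro bexI[of _ "strands n T \<odot> \<delta>"]) (simp_all add: \<mu>_Some[OF \<epsilon>] del: One_nat_def)
      qed
      then show "x \<in> {Some ?\<epsilon>} \<union> {\<mu> (Some ?\<epsilon>) \<alpha> | \<alpha>. \<alpha> \<in> D}"
        by blast
    qed
  qed
qed

lemma deg_rc_le: "deg_rc M \<le> 1 + card Q"
proof -
  have "Q \<subseteq> D"
    by (auto simp: Q dest: projD(1))
  then have fin: "finite Q"
    using finite_D finite_subset by blast
  have "deg_rc M \<le> card Qm"
    using fin monoid_diagram_monoid right_action faithful_action monogenic_action
    by (intro deg_rc_le_card_of_action) (simp_all add: M Qm)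
  also have "card Qm = 1 + card Q"
    using fin by (simp add: Qm card_image image_iff)
  finally show ?thesis .
qed

lemma deg_le: "deg M \<le> deg_rc M"
  using deg_le_deg_rc[OF monoid_diagram_monoid] finite_D by (simp add: M diagram_monoid_def)

end

section \<open>The four monoids\<close>

lemma diagram_class_partitions: "n \<ge> 2 \<Longrightarrow> diagram_class n (partitions n)"
  by unfold_locales
    (simp_all add: diagram_mult_partitions star_partitions partial_injection.strands_partitions cup_partitions)

lemma diagram_class_partial_brauer:
  assumes "n \<ge> 2"
  shows "diagram_class n {\<alpha> \<in> partitions n. \<forall>B\<in>\<alpha>. card B \<le> 2}" (is "diagram_class n ?D")
proof
  show "diagram_mult n \<alpha> \<beta> \<in> ?D" if "\<alpha> \<in> ?D" "\<beta> \<in> ?D" for \<alpha> \<beta>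
    using that small_blocks_mult[of \<alpha> n \<beta>] diagram_mult_partitions[of \<alpha> n \<beta>] by blast
  show "star \<alpha> \<in> ?D" if "\<alpha> \<in> ?D" for \<alpha>
    using that small_blocks_star[of \<alpha>] star_partitions[of \<alpha> n] by blast
qed (simp_all add: assms partial_injection.strands_partitions cup_partitions
    partial_injection.strands_small_blocks cup_small_blocks)

lemma diagram_class_planar:
  "n \<ge> 2 \<Longrightarrow> diagram_class n {\<alpha> \<in> partitions n. planar n \<alpha>}"
  by unfold_locales
    (simp_all add: diagram_mult_partitions star_partitions partial_injection.strands_partitions cup_partitions
      planar_mult planar_star partial_injection.strands_planar cup_planar)

text \<open>Provides the Motzkin case: each requirement beyond the bound on \<open>n\<close> is a
  closure property, a membership or an inclusion, and these pass to intersections.\<close>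

lemma diagram_class_Int:
  assumes "diagram_class n D" "diagram_class n E"
  shows "diagram_class n (D \<inter> E)"
proof -
  interpret D: diagram_class n D by (fact assms(1))
  interpret E: diagram_class n E by (fact assms(2))
  show ?thesis
  proof
    show "strands n T \<in> D \<inter> E"
      if "partial_injection n T" "\<And>x y x' y'. (x, y) \<in> T \<Longrightarrow> (x', y') \<in> T \<Longrightarrow> x < x' \<Longrightarrow> y < y'" for T
      using that by (intro IntI D.strands_closed E.strands_closed)
  qed (simp_all add: D.n_ge_2 D.partitions D.mult_closed E.mult_closed D.star_closed E.star_closed
      D.cup_closed E.cup_closed)
qed

theorem theorem4p9:
  fixes n :: nat and M :: "diagram monoid"
    and Q :: "diagram set" and Qm :: "diagram option set"
    and \<mu> :: "diagram option \<Rightarrow> diagram \<Rightarrow> diagram option"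
  assumes "n \<ge> 2"
    and "M \<in> {partition_monoid n, partial_brauer_monoid n,
              planar_partition_monoid n, motzkin_monoid n}"
    and "Q = {\<epsilon> \<in> projections M. rank \<epsilon> \<le> 2}"
    and "Qm = Some ` Q \<union> {None}"
    and "\<And>\<epsilon> \<alpha>. \<epsilon> \<in> Q \<Longrightarrow> \<alpha> \<in> carrier M \<Longrightarrow>
           \<mu> (Some \<epsilon>) \<alpha> =
             (if ker \<epsilon> = ker (\<epsilon> \<otimes>\<^bsub>M\<^esub> \<alpha>) then Some (star \<alpha> \<otimes>\<^bsub>M\<^esub> \<epsilon> \<otimes>\<^bsub>M\<^esub> \<alpha>) else None)"
    and "\<And>\<alpha>. \<alpha> \<in> carrier M \<Longrightarrow> \<mu> None \<alpha> = None"
  shows "right_action M Qm \<mu> \<and> faithful_action M Qm \<mu> \<and> monogenic_action M Qm \<mu> \<and>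
         deg M \<le> deg_rc M \<and> deg_rc M \<le> 1 + card Q"
proof -
  note classes = diagram_class_partitions[OF assms(1)] diagram_class_partial_brauer[OF assms(1)]
    diagram_class_planar[OF assms(1)] 
  obtain D where D: "diagram_class n D" and M: "M = diagram_monoid n D"
  proof -
    have "carrier (planar_partition_monoid n) = {\<alpha> \<in> partitions n. planar n \<alpha>}"
      "carrier (partial_brauer_monoid n) = {\<alpha> \<in> partitions n. \<forall>B\<in>\<alpha>. card B \<le> 2}"
      by (simp_all add: planar_partition_monoid_def partial_brauer_monoid_def diagram_monoid_def)
    then show thesis
      using that[OF classes(1)] that[OF classes(2)] that[OF classes(3)]
        that[OF diagram_class_Int[OF classes(3,2)]] assms(2)
      by (simp only: insert_iff empty_iff simp_thms partition_monoid_def partial_brauer_monoid_def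
          planar_partition_monoid_def motzkin_monoid_def) metis
  qed
  interpret diagram_class n D by (fact D)
  have "projections M = proj"
    by (simp add: projections_def proj_def M diagram_monoid_def)
  then interpret projection_action n D M Q Qm \<mu>
    using assms(3-6) by unfold_locales (simp_all add: M diagram_monoid_def)
  show ?thesis
    by (intro conjI right_action faithful_action monogenic_action deg_le deg_rc_le)
qed

end
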